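(* Let $m\ge 1$ be an integer and let $\lambda=(\lambda_0,\dots,\lambda_m,\dots,\lambda_0)$ be a symmetric vector (of length $2m+1$) of positive real weights. Let $\eta_0,\dots,\eta_m$ be i.i.d. real-valued standard Gaussian random variables and define the random trigonometric polynomial \[ F(\theta):=\frac{\lambda_m}{2}\,\eta_m+\frac{1}{\sqrt2}\sum_{k=1}^m \lambda_{m-k}\,\eta_{m-k}\cos(k\theta). \] For $-\pi\le\beta_1<\beta_2\le\pi$ let $\mu_F([\beta_1,\beta_2])$ denote the number of real roots of $F$ lying in $[\beta_1,\beta_2]$. Then \[ \mathbb{E}\,\mu_F([\beta_1,\beta_2])=\frac{1}{\pi}\int_{\beta_1}^{\beta_2}p_\lambda(t)\,dt, \] where \[ p_{\lambda}(t):=\left[\frac{\partial^2}{\partial x\,\partial y}\log\left(\frac{\lambda_m^{2}}{2}+\sum_{k=1}^{m}\lambda_{m-k}^{2}\cos(kx)\cos(ky)\right)\Big|_{x=y=t}\right]^{1/2}. \]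
   Context: $\mathbb{E}$ denotes expectation. *)

theory Defs
  imports "HOL-Probability.Probability"
begin

text \<open>
  The symmetric vector \<open>(\<lambda>\<^sub>0, \<dots>, \<lambda>\<^sub>m, \<dots>, \<lambda>\<^sub>0)\<close> is a function on the indices \<open>0, \<dots>, 2m\<close>.
\<close>

definition symmetric_weights :: "nat \<Rightarrow> (nat \<Rightarrow> real) \<Rightarrow> bool" where
  "symmetric_weights m w \<longleftrightarrow>
     (\<forall>i\<le>2 * m. w i > 0) \<and> (\<forall>i\<le>2 * m. w (2 * m - i) = w i)"

definition trig_poly :: "nat \<Rightarrow> (nat \<Rightarrow> real) \<Rightarrow> (nat \<Rightarrow> real) \<Rightarrow> real \<Rightarrow> real" where
  "trig_poly m w e \<theta> =
     w m / 2 * e m + 1 / sqrt 2 * (\<Sum>k=1..m. w (m - k) * e (m - k) * cos (real k * \<theta>))"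

text \<open>
  Roots are counted without multiplicity, as points of the closed interval. Note that \<open>card\<close> of this
  set is \<open>0\<close> when it is infinite.
\<close>

definition roots_in :: "(real \<Rightarrow> real) \<Rightarrow> real \<Rightarrow> real \<Rightarrow> real set" where
  "roots_in f a b = {\<theta> \<in> {a..b}. f \<theta> = 0}"

text \<open>
  For standard Gaussian coefficients this is twice the covariance of \<open>trig_poly\<close> at \<open>x\<close> and \<open>y\<close>.
\<close>

definition kernel :: "nat \<Rightarrow> (nat \<Rightarrow> real) \<Rightarrow> real \<Rightarrow> real \<Rightarrow> real" where
  "kernel m w x y =
     (w m)\<^sup>2 / 2 + (\<Sum>k=1..m. (w (m - k))\<^sup>2 * cos (real k * x) * cos (real k * y))"

definition root_density :: "nat \<Rightarrow> (nat \<Rightarrow> real) \<Rightarrow> real \<Rightarrow> real" where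
  "root_density m w t = sqrt (deriv (\<lambda>x. deriv (\<lambda>y. ln (kernel m w x y)) t) t)"

end

theory Submission
  imports Defs
begin

text \<open>
  Since the coefficient of \<open>\<eta>\<^sub>m\<close> is a nonzero constant, the roots are the solutions of \<open>h t = \<eta>\<^sub>m\<close>, where
  \<open>h\<close> is a smooth function that depends only on the remaining coefficients. The Banach indicatrix
  formula turns the conditional expectation of their number into the integral of \<open>\<phi> (h t) * \<bar>h' t\<bar>\<close>, with
  \<open>\<phi>\<close> the standard normal density, and by Fubini it remains to compute the expectation of
  \<open>\<phi> Y * \<bar>X\<bar>\<close> for the centered jointly Gaussian pair \<open>X = h' t\<close>, \<open>Y = h t\<close>. Weighting with \<open>\<phi> Y\<close> amounts
  to conditioning \<open>X\<close> on an observation of \<open>Y\<close> with independent standard normal noise.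

  Roots are counted by the counting measure, which, unlike \<open>card\<close>, is infinite on infinite sets.
\<close>

section \<open>Counting roots on dyadic grids\<close>

text \<open>The obstacle is that \<open>h\<close> may be neither monotone nor free of degenerate
  crossings: \<open>h'\<close> always vanishes at \<open>0\<close>, and exceptional coefficients
  give double roots or a constant \<open>h\<close>. Counting the grid cells that contain a root
  avoids every case distinction: these counts are measurable, increase under dyadic refinement and
  tend to the number of roots even if it is infinite. All integrals are of nonnegative extended
  functions, so limits and Fubini need no prior bound, and almost sure finiteness comes out at the
  end from the finite value of the expectation. The logarithm in the density arises as follows. The
  noisy observation of \<open>Y\<close> has variance \<open>S\<close>, which is \<open>1\<close>,
  the variance of \<eta>_m, plus the sum of the squared coefficients of \<open>Y\<close>; up to the
  factor \<open>2 / (w m)^2\<close> this is the kernel \<open>K\<close> on the diagonal. The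
  conditional variance of \<open>X\<close> divided by \<open>S\<close> is
  \<open>(K * Kxy - Kx^2) / K^2\<close>, the mixed derivative of \<open>ln K\<close>, and a constant
  factor in \<open>K\<close> does not affect it.\<close>

text \<open>Half-open cells make the index a function of the point. The right endpoint
  \<open>b\<close> lies in none of the first \<open>2 ^ n\<close> cells; it gets the index
  \<open>2 ^ n\<close> to itself and is treated separately throughout.\<close>

definition grid_index :: "real \<Rightarrow> real \<Rightarrow> nat \<Rightarrow> real \<Rightarrow> nat" where
  "grid_index a b n t = nat \<lfloor>2 ^ n * ((t - a) / (b - a))\<rfloor>"

definition grid_point :: "real \<Rightarrow> real \<Rightarrow> nat \<Rightarrow> nat \<Rightarrow> real" where
  "grid_point a b n j = a + real j * ((b - a) / 2 ^ n)"

lemma grid_point_diff: "grid_point a b n (Suc j) - grid_point a b n j = (b - a) / 2 ^ n"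
  by (simp add: grid_point_def distrib_right add_divide_distrib)

lemma grid_point_0 [simp]: "grid_point a b n 0 = a"
  and grid_point_last [simp]: "grid_point a b n (2 ^ n) = b"
  by (simp_all add: grid_point_def)

lemma grid_point_bounds:
  assumes "a < b" "j \<le> 2 ^ n"
  shows "a \<le> grid_point a b n j" "grid_point a b n j \<le> b"
proof -
  have "real j \<le> 2 ^ n"
    using assms(2) by (metis of_nat_le_iff of_nat_numeral of_nat_power)
  then have "real j * ((b - a) / 2 ^ n) \<le> 2 ^ n * ((b - a) / 2 ^ n)"
    using assms by (intro mult_right_mono) auto
  then show "grid_point a b n j \<le> b" by (simp add: grid_point_def)
  show "a \<le> grid_point a b n j" using assms by (simp add: grid_point_def)
qed

lemma grid_index_eq_iff:
  assumes "a < b" "a \<le> t"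
  shows "grid_index a b n t = j \<longleftrightarrow> t \<in> {grid_point a b n j ..< grid_point a b n (Suc j)}"
proof -
  have "0 \<le> 2 ^ n * ((t - a) / (b - a))" using assms by simp
  then have "grid_index a b n t = j \<longleftrightarrow> \<lfloor>2 ^ n * ((t - a) / (b - a))\<rfloor> = int j"
    unfolding grid_index_def by (smt (verit) nat_eq_iff zero_le_floor of_nat_0_le_iff nat_int)
  also have "\<dots> \<longleftrightarrow> real j \<le> 2 ^ n * ((t - a) / (b - a)) \<and> 2 ^ n * ((t - a) / (b - a)) < real j + 1"
    by (simp add: floor_eq_iff)
  also have "\<dots> \<longleftrightarrow> t \<in> {grid_point a b n j ..< grid_point a b n (Suc j)}"
    using assms by (auto simp: grid_point_def field_simps)
  finally show ?thesis .
qed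

lemma grid_index_le:
  assumes "a < b" "t \<in> {a..b}"
  shows "grid_index a b n t \<le> 2 ^ n"
proof -
  have "2 ^ n * ((t - a) / (b - a)) \<le> 2 ^ n" using assms by (simp add: field_simps)
  then have "\<lfloor>2 ^ n * ((t - a) / (b - a))\<rfloor> \<le> \<lfloor>2 ^ n :: real\<rfloor>" by (rule floor_mono)
  also have "\<lfloor>2 ^ n :: real\<rfloor> = 2 ^ n"
    by (metis floor_of_int of_int_numeral of_int_power)
  finally show ?thesis unfolding grid_index_def
    by (simp add: nat_le_iff)
qed

lemma grid_cell:
  assumes "a < b"
  shows "j < 2 ^ n \<Longrightarrow> {t\<in>{a..b}. grid_index a b n t = j} = {grid_point a b n j ..< grid_point a b n (Suc j)}"
    and "{t\<in>{a..b}. grid_index a b n t = 2 ^ n} = {b}"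
proof -
  show "{t\<in>{a..b}. grid_index a b n t = j} = {grid_point a b n j ..< grid_point a b n (Suc j)}" if "j < 2 ^ n"
  proof -
    have "a \<le> grid_point a b n j" "grid_point a b n (Suc j) \<le> b"
      using grid_point_bounds[OF assms] that by auto
    moreover have "{t\<in>{a..b}. grid_index a b n t = j} =
        {a..b} \<inter> {grid_point a b n j ..< grid_point a b n (Suc j)}"
      using grid_index_eq_iff[OF assms, of _ n j] unfolding set_eq_iff mem_Collect_eq Int_iff atLeastAtMost_iff by blast
    ultimately show ?thesis by (simp add: Int_absorb1 subset_iff)
  qed
  have "b < grid_point a b n (Suc (2 ^ n))"
    using assms by (simp add: grid_point_def distrib_right field_simps)
  then show "{t\<in>{a..b}. grid_index a b n t = 2 ^ n} = {b}"
    using grid_index_eq_iff[OF assms, of _ n "2 ^ n"] assms by auto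
qed

text \<open>Each dyadic cell splits into two at the next level, so coarsening drops the last binary
  digit of the index. This nesting makes the counts below monotone, as monotone convergence
  requires.\<close>

lemma grid_index_div_2:
  assumes "a < b" "a \<le> t"
  shows "grid_index a b n t = grid_index a b (Suc n) t div 2"
proof -
  let ?x = "2 ^ Suc n * ((t - a) / (b - a))"
  have "0 \<le> ?x" using assms by simp
  have "2 ^ n * ((t - a) / (b - a)) = ?x / real_of_int 2" using assms by (simp add: field_simps)
  then have "\<lfloor>2 ^ n * ((t - a) / (b - a))\<rfloor> = \<lfloor>?x / real_of_int 2\<rfloor>" by (rule arg_cong)
  also have "\<dots> = \<lfloor>?x\<rfloor> div 2" by (rule floor_divide_real_eq_div) simp
  finally show ?thesis
    using \<open>0 \<le> ?x\<close> unfolding grid_index_def by (simp add: nat_div_distrib)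
qed

lemma finite_grid_index_image:
  assumes "a < b" "S \<subseteq> {a..b}"
  shows "finite (grid_index a b n ` S)"
proof (rule finite_subset)
  show "grid_index a b n ` S \<subseteq> {..2 ^ n}"
    using grid_index_le[OF assms(1)] assms(2) by blast
qed simp

lemma card_grid_index_mono:
  assumes "a < b" "S \<subseteq> {a..b}"
  shows "incseq (\<lambda>n. card (grid_index a b n ` S))"
proof (rule incseq_SucI)
  fix n
  have "grid_index a b n ` S = (\<lambda>i. i div 2) ` grid_index a b (Suc n) ` S"
    unfolding image_image
  proof (rule image_cong)
    fix t assume "t \<in> S"
    then have "a \<le> t" using assms(2) by auto
    then show "grid_index a b n t = grid_index a b (Suc n) t div 2"
      by (rule grid_index_div_2[OF assms(1)])
  qed simp
  then show "card (grid_index a b n ` S) \<le> card (grid_index a b (Suc n) ` S)"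
    using card_image_le finite_grid_index_image[OF assms] by metis
qed

lemma grid_index_eventually_inj_on:
  assumes "a < b" "finite F" "F \<subseteq> {a..b}"
  shows "\<forall>\<^sub>F n in sequentially. inj_on (grid_index a b n) F"
proof -
  have "\<forall>\<^sub>F n in sequentially. x \<noteq> y \<longrightarrow> grid_index a b n x \<noteq> grid_index a b n y"
    if xy: "x \<in> F" "y \<in> F" for x y
  proof (cases "x = y")
    case False
    \<comment> \<open>From level \<open>k\<close> on the mesh is smaller than the distance of
      \<open>x\<close> and \<open>y\<close>, so they cannot share a cell.\<close>
    obtain k where k: "(b - a) / \<bar>x - y\<bar> < 2 ^ k"
      using real_arch_pow[of 2 "(b - a) / \<bar>x - y\<bar>"] by auto
    have "grid_index a b n x \<noteq> grid_index a b n y" if "n \<ge> k" for n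
    proof
      assume eq: "grid_index a b n x = grid_index a b n y"
      let ?j = "grid_index a b n x"
      have "x \<in> {grid_point a b n ?j ..< grid_point a b n (Suc ?j)}"
           "y \<in> {grid_point a b n ?j ..< grid_point a b n (Suc ?j)}"
        using grid_index_eq_iff[OF assms(1), of x n ?j] grid_index_eq_iff[OF assms(1), of y n ?j] eq xy assms(3) by auto
      then have "\<bar>x - y\<bar> < (b - a) / 2 ^ n"
        using grid_point_diff[of a b n ?j] by auto
      moreover have "(b - a) / 2 ^ n \<le> (b - a) / 2 ^ k"
        using that assms(1) by (intro divide_left_mono) auto
      moreover have "(b - a) / 2 ^ k < \<bar>x - y\<bar>"
        using k False by (simp add: field_simps)
      ultimately show False by linarith
    qed
    then show ?thesis by (auto simp: eventually_sequentially)
  qed auto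
  then have "\<forall>\<^sub>F n in sequentially. \<forall>x\<in>F. \<forall>y\<in>F. x \<noteq> y \<longrightarrow> grid_index a b n x \<noteq> grid_index a b n y"
    using assms(2) by (intro eventually_ball_finite ballI) auto
  then show ?thesis by (rule eventually_mono) (auto simp: inj_on_def)
qed

text \<open>The grid eventually separates any finite subset of \<open>S\<close>, so the counts reach
  the size of each of them. For infinite \<open>S\<close> these sizes are unbounded and the supremum
  is infinite, in agreement with the counting measure.\<close>

lemma emeasure_count_space_eq_SUP_grid:
  assumes "a < b" "S \<subseteq> {a..b}"
  shows "emeasure (count_space UNIV) S = (SUP n. of_nat (card (grid_index a b n ` S)))"
proof (rule antisym)
  have card_le: "of_nat (card F) \<le> (SUP n. of_nat (card (grid_index a b n ` S)) :: ennreal)"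
    if F: "finite F" "F \<subseteq> S" for F
  proof -
    obtain n where n: "inj_on (grid_index a b n) F"
      using eventually_happens'[OF _ grid_index_eventually_inj_on[OF assms(1) F(1)]] F assms by auto
    have "card F = card (grid_index a b n ` F)" using n by (simp add: card_image)
    also have "\<dots> \<le> card (grid_index a b n ` S)"
      using F finite_grid_index_image[OF assms] by (intro card_mono) auto
    finally show ?thesis by (intro SUP_upper2[of n]) auto
  qed
  show "emeasure (count_space UNIV) S \<le> (SUP n. of_nat (card (grid_index a b n ` S)))"
  proof (cases "finite S")
    case True
    then show ?thesis using card_le[of S] by simp
  next
    case False
    have "of_nat k \<le> (SUP n. of_nat (card (grid_index a b n ` S)) :: ennreal)" for k
      using infinite_arbitrarily_large[OF False, of k] card_le by auto
    then have "(SUP k. of_nat k :: ennreal) \<le> (SUP n. of_nat (card (grid_index a b n ` S)))"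
      by (intro SUP_least) auto
    then have "(SUP n. of_nat (card (grid_index a b n ` S)) :: ennreal) = \<top>"
      unfolding ennreal_SUP_of_nat_eq_top top_unique .
    then show ?thesis by (metis top_greatest)
  qed
  show "(SUP n. of_nat (card (grid_index a b n ` S))) \<le> emeasure (count_space UNIV) S"
  proof (cases "finite S")
    case True
    then show ?thesis using card_image_le[OF True] by (auto intro!: SUP_least)
  qed auto
qed

text \<open>By compactness a continuous function has a root iff its absolute value has infimum zero,
  and by continuity this infimum may be tested at countably many points. Only countable unions and
  intersections of measurable events remain.\<close>

lemma sets_has_root_Icc:
  fixes F :: "'a \<Rightarrow> real \<Rightarrow> real"
  assumes cont: "\<And>\<omega>. \<omega> \<in> space M \<Longrightarrow> continuous_on {c..d} (F \<omega>)"
    and meas: "\<And>t. t \<in> {c..d} \<Longrightarrow> (\<lambda>\<omega>. F \<omega> t) \<in> borel_measurable M"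
  shows "{\<omega> \<in> space M. \<exists>t\<in>{c..d}. F \<omega> t = 0} \<in> sets M"
proof (cases "c \<le> d")
  case True
  \<comment> \<open>Clamping lets the quantifier run over all rationals; the interval itself may
    contain none, as when \<open>c = d\<close> is irrational.\<close>
  define clamp where "clamp q = max c (min d q)" for q :: real
  have clamp: "clamp q \<in> {c..d}" for q using True by (auto simp: clamp_def)
  have "(\<exists>t\<in>{c..d}. F \<omega> t = 0) \<longleftrightarrow> (\<forall>n::nat. \<exists>q::rat. \<bar>F \<omega> (clamp (of_rat q))\<bar> < inverse (real (Suc n)))"
    if \<omega>: "\<omega> \<in> space M" for \<omega>
  proof
    assume "\<exists>t\<in>{c..d}. F \<omega> t = 0"
    then obtain t where t: "t \<in> {c..d}" "F \<omega> t = 0" by auto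
    have "continuous_on UNIV (F \<omega> \<circ> clamp)"
      using clamp cont[OF \<omega>] unfolding clamp_def
      by (intro continuous_on_compose continuous_intros) (auto intro: continuous_on_subset)
    then have isc: "isCont (F \<omega> \<circ> clamp) t" by (metis UNIV_I continuous_on_eq_continuous_at open_UNIV)
    have t0: "(F \<omega> \<circ> clamp) t = 0" using t by (auto simp: clamp_def)
    show "\<forall>n::nat. \<exists>q::rat. \<bar>F \<omega> (clamp (of_rat q))\<bar> < inverse (real (Suc n))"
    proof
      fix n :: nat
      have "inverse (real (Suc n)) > 0" by simp
      then obtain \<delta> where \<delta>: "\<delta> > 0" "\<And>x. dist x t < \<delta> \<Longrightarrow> dist ((F \<omega> \<circ> clamp) x) 0 < inverse (real (Suc n))"
        using isc t0 unfolding continuous_at_eps_delta by metis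
      obtain q where "t < of_rat q" "of_rat q < t + \<delta>" using of_rat_dense[of t "t + \<delta>"] \<delta>(1) by auto
      then show "\<exists>q::rat. \<bar>F \<omega> (clamp (of_rat q))\<bar> < inverse (real (Suc n))"
        using \<delta>(2)[of "of_rat q"] by (intro exI[of _ q]) (auto simp: dist_real_def)
    qed
  next
    assume R: "\<forall>n::nat. \<exists>q::rat. \<bar>F \<omega> (clamp (of_rat q))\<bar> < inverse (real (Suc n))"
    have "continuous_on {c..d} (\<lambda>t. \<bar>F \<omega> t\<bar>)" using cont[OF \<omega>] by (intro continuous_intros)
    then obtain t where t: "t \<in> {c..d}" "\<And>s. s \<in> {c..d} \<Longrightarrow> \<bar>F \<omega> t\<bar> \<le> \<bar>F \<omega> s\<bar>"
      using continuous_attains_inf[of "{c..d}"] True by fastforce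
    have "F \<omega> t = 0"
    proof (rule ccontr)
      assume "F \<omega> t \<noteq> 0"
      then obtain n where n: "inverse (real (Suc n)) < \<bar>F \<omega> t\<bar>"
        using reals_Archimedean[of "\<bar>F \<omega> t\<bar>"] by auto
      obtain q where "\<bar>F \<omega> (clamp (of_rat q))\<bar> < inverse (real (Suc n))" using R by auto
      with n t(2)[OF clamp] show False by (meson less_trans not_le)
    qed
    with t show "\<exists>t\<in>{c..d}. F \<omega> t = 0" by auto
  qed
  then have eq: "{\<omega> \<in> space M. \<exists>t\<in>{c..d}. F \<omega> t = 0} =
      {\<omega> \<in> space M. \<forall>n::nat. \<exists>q::rat. \<bar>F \<omega> (clamp (of_rat q))\<bar> < inverse (real (Suc n))}" by auto
  have [measurable]: "(\<lambda>\<omega>. F \<omega> (clamp q)) \<in> borel_measurable M" for q using meas[OF clamp] .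
  show ?thesis unfolding eq by measurable
qed auto

lemma sets_has_root_Ico:
  fixes F :: "'a \<Rightarrow> real \<Rightarrow> real"
  assumes cont: "\<And>\<omega>. \<omega> \<in> space M \<Longrightarrow> continuous_on {c..<d} (F \<omega>)"
    and meas: "\<And>t. t \<in> {c..<d} \<Longrightarrow> (\<lambda>\<omega>. F \<omega> t) \<in> borel_measurable M"
  shows "{\<omega> \<in> space M. \<exists>t\<in>{c..<d}. F \<omega> t = 0} \<in> sets M"
proof -
  have "t \<in> {c..<d} \<longleftrightarrow> (\<exists>n. t \<in> {c..d - inverse (real (Suc n))})" for t
  proof
    assume t: "t \<in> {c..<d}"
    then obtain n where "inverse (real (Suc n)) < d - t"
      using reals_Archimedean[of "d - t"] by auto
    then have "t \<in> {c..d - inverse (real (Suc n))}" using t by auto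
    then show "\<exists>n. t \<in> {c..d - inverse (real (Suc n))}" ..
  next
    assume "\<exists>n. t \<in> {c..d - inverse (real (Suc n))}"
    then obtain n where "t \<in> {c..d - inverse (real (Suc n))}" ..
    moreover have "inverse (real (Suc n)) > 0" by simp
    ultimately show "t \<in> {c..<d}" unfolding atLeastAtMost_iff atLeastLessThan_iff by linarith
  qed
  then have "{\<omega> \<in> space M. \<exists>t\<in>{c..<d}. F \<omega> t = 0} =
      (\<Union>n. {\<omega> \<in> space M. \<exists>t\<in>{c..d - inverse (real (Suc n))}. F \<omega> t = 0})" by blast
  also have "\<dots> \<in> sets M"
  proof (intro sets.countable_UN'' sets_has_root_Icc)
    fix n
    have "0 < inverse (real (Suc n))" by simp
    then have sub: "{c..d - inverse (real (Suc n))} \<subseteq> {c..<d}"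
    proof (intro subsetI)
      fix t assume "t \<in> {c..d - inverse (real (Suc n))}"
      then show "t \<in> {c..<d}"
        using \<open>0 < inverse (real (Suc n))\<close> unfolding atLeastAtMost_iff atLeastLessThan_iff by linarith
    qed
    show "continuous_on {c..d - inverse (real (Suc n))} (F \<omega>)" if "\<omega> \<in> space M" for \<omega>
      using cont[OF that] sub continuous_on_subset by blast
    show "(\<lambda>\<omega>. F \<omega> t) \<in> borel_measurable M" if "t \<in> {c..d - inverse (real (Suc n))}" for t
      using meas sub that by blast
  qed auto
  finally show ?thesis .
qed

text \<open>As a sum of indicators of root events the count can be both proved measurable and
  integrated over the level. The last summand is the cell consisting of \<open>b\<close>
  alone.\<close>

lemma card_grid_index_roots:
  assumes "a < b"
  shows "(of_nat (card (grid_index a b n ` roots_in f a b)) :: ennreal) =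
    (\<Sum>j<2 ^ n. of_bool (\<exists>t\<in>{grid_point a b n j ..< grid_point a b n (Suc j)}. f t = 0)) + of_bool (f b = 0)"
proof -
  let ?P = "\<lambda>j. \<exists>t\<in>{a..b}. grid_index a b n t = j \<and> f t = 0"
  have "grid_index a b n ` roots_in f a b = {j\<in>{..2 ^ n}. ?P j}"
    using grid_index_le[OF assms] by (auto simp: roots_in_def)
  then have "of_nat (card (grid_index a b n ` roots_in f a b)) = (\<Sum>j\<le>2 ^ n. of_bool (?P j) :: ennreal)"
    by (simp add: of_bool_def sum.If_cases Int_def)
  also have "{..2 ^ n} = insert (2 ^ n) {..<2 ^ n :: nat}" by auto
  also have "(\<Sum>j\<in>insert (2 ^ n) {..<2 ^ n}. of_bool (?P j) :: ennreal) =
      (\<Sum>j<2 ^ n. of_bool (?P j)) + of_bool (?P (2 ^ n))"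
    by (simp add: add.commute)
  also have "?P (2 ^ n) \<longleftrightarrow> f b = 0"
  proof -
    have "t \<in> {a..b} \<and> grid_index a b n t = 2 ^ n \<longleftrightarrow> t = b" for t
      using grid_cell(2)[OF assms, of n] unfolding set_eq_iff by simp
    then show ?thesis unfolding Bex_def by (metis (no_types, lifting))
  qed
  also have "(\<Sum>j<2 ^ n. of_bool (?P j)) = (\<Sum>j<2 ^ n. of_bool (\<exists>t\<in>{grid_point a b n j ..< grid_point a b n (Suc j)}. f t = 0) :: ennreal)"
  proof (intro sum.cong refl arg_cong[of _ _ of_bool])
    fix j assume "j \<in> {..<2 ^ n :: nat}"
    then have "{t\<in>{a..b}. grid_index a b n t = j} = {grid_point a b n j ..< grid_point a b n (Suc j)}"
      using grid_cell(1)[OF assms, of j n] by simp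
    then have "t \<in> {grid_point a b n j ..< grid_point a b n (Suc j)} \<longleftrightarrow> t \<in> {a..b} \<and> grid_index a b n t = j" for t
      unfolding set_eq_iff by blast
    then show "?P j = (\<exists>t\<in>{grid_point a b n j ..< grid_point a b n (Suc j)}. f t = 0)"
      unfolding Bex_def by (metis (no_types, lifting))
  qed
  finally show ?thesis .
qed

lemma borel_measurable_of_bool_ennreal:
  "{\<omega> \<in> space M. P \<omega>} \<in> sets M \<Longrightarrow> (\<lambda>\<omega>. of_bool (P \<omega>) :: ennreal) \<in> borel_measurable M"
  unfolding of_bool_def by (intro measurable_If) auto

lemma borel_measurable_card_grid_index_roots:
  fixes F :: "'a \<Rightarrow> real \<Rightarrow> real"
  assumes "a < b"
    and cont: "\<And>\<omega>. \<omega> \<in> space M \<Longrightarrow> continuous_on {a..b} (F \<omega>)"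
    and meas: "\<And>t. t \<in> {a..b} \<Longrightarrow> (\<lambda>\<omega>. F \<omega> t) \<in> borel_measurable M"
  shows "(\<lambda>\<omega>. of_nat (card (grid_index a b n ` roots_in (F \<omega>) a b)) :: ennreal) \<in> borel_measurable M"
  unfolding card_grid_index_roots[OF assms(1)]
proof (intro borel_measurable_add borel_measurable_sum borel_measurable_of_bool_ennreal sets_has_root_Ico)
  fix j assume j: "j \<in> {..<2 ^ n :: nat}"
  have sub: "{grid_point a b n j ..< grid_point a b n (Suc j)} \<subseteq> {a..b}"
    using grid_cell(1)[OF assms(1), of j n] j by auto
  show "continuous_on {grid_point a b n j ..< grid_point a b n (Suc j)} (F \<omega>)" if "\<omega> \<in> space M" for \<omega>
    using continuous_on_subset[OF cont[OF that] sub] .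
  show "(\<lambda>\<omega>. F \<omega> t) \<in> borel_measurable M" if "t \<in> {grid_point a b n j ..< grid_point a b n (Suc j)}" for t
    using meas sub that by auto
next
  have [measurable]: "(\<lambda>\<omega>. F \<omega> b) \<in> borel_measurable M" using meas assms(1) by auto
  show "{\<omega> \<in> space M. F \<omega> b = 0} \<in> sets M" by measurable
qed

lemma borel_measurable_count_roots:
  fixes F :: "'a \<Rightarrow> real \<Rightarrow> real"
  assumes "a < b"
    and cont: "\<And>\<omega>. \<omega> \<in> space M \<Longrightarrow> continuous_on {a..b} (F \<omega>)"
    and meas: "\<And>t. t \<in> {a..b} \<Longrightarrow> (\<lambda>\<omega>. F \<omega> t) \<in> borel_measurable M"
  shows "(\<lambda>\<omega>. emeasure (count_space UNIV) (roots_in (F \<omega>) a b)) \<in> borel_measurable M"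
proof -
  have sub: "roots_in f a b \<subseteq> {a..b}" for f by (auto simp: roots_in_def)
  show ?thesis
    unfolding emeasure_count_space_eq_SUP_grid[OF assms(1) sub]
    by (intro borel_measurable_SUP borel_measurable_card_grid_index_roots assms) auto
qed

section \<open>The Banach indicatrix formula\<close>

lemma continuous_has_antiderivative:
  fixes f :: "real \<Rightarrow> real"
  assumes "continuous_on UNIV f"
  obtains F where "\<And>x. (F has_real_derivative f x) (at x)"
proof -
  have "\<exists>F. \<forall>x::real. -\<infinity> < ereal x \<longrightarrow> ereal x < \<infinity> \<longrightarrow> (F has_vector_derivative f x) (at x)"
    using assms by (intro einterval_antiderivative) (auto simp: continuous_on_eq_continuous_at)
  then show ?thesis
    using that by (auto simp: has_real_derivative_iff_has_vector_derivative)
qed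

lemma emeasure_density_Icc:
  fixes f F :: "real \<Rightarrow> real"
  assumes "f \<in> borel_measurable borel" "\<And>x. 0 \<le> f x"
    and "\<And>x. (F has_real_derivative f x) (at x)" "c \<le> d"
  shows "emeasure (density lborel f) {c..d} = ennreal (F d - F c)"
  using nn_integral_FTC_Icc[of f c d F] assms
  by (subst emeasure_density) auto

text \<open>Up to one point the image contains the segment between \<open>h l\<close> and
  \<open>h u\<close>, by the intermediate value theorem, and it lies in the segment between the
  extremes of \<open>h\<close>. The masses of both segments are increments of
  \<open>g t = \<Psi> (h t)\<close>, hence slopes
  \<open>\<psi> (h \<xi>) * \<bar>h' \<xi>\<bar>\<close> times a length of at most
  \<open>u - l\<close>. By \<open>osc\<close> all these slopes are close to the slope of
  \<open>G\<close> at \<open>\<zeta>\<close>.\<close>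

lemma image_cell_measure_bounds:
  fixes h h' \<psi> \<Psi> G :: "real \<Rightarrow> real"
  assumes h: "\<And>t. (h has_real_derivative h' t) (at t)"
    and \<psi>: "continuous_on UNIV \<psi>" "\<And>y. 0 \<le> \<psi> y"
    and \<Psi>: "\<And>y. (\<Psi> has_real_derivative \<psi> y) (at y)"
    and G: "\<And>t. (G has_real_derivative \<psi> (h t) * \<bar>h' t\<bar>) (at t)"
    and lu: "l < u"
    and osc: "\<And>s t. s \<in> {l..u} \<Longrightarrow> t \<in> {l..u} \<Longrightarrow> \<psi> (h s) * \<bar>h' s\<bar> \<le> \<psi> (h t) * \<bar>h' t\<bar> + \<epsilon>"
  obtains r where "0 \<le> r" "emeasure (density lborel \<psi>) (h ` {l..<u}) = ennreal r"
    "\<bar>r - (G u - G l)\<bar> \<le> \<epsilon> * (u - l)"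
proof -
  let ?D = "density lborel \<psi>"
  define g where "g t = \<Psi> (h t)" for t
  have \<psi>_meas [measurable]: "\<psi> \<in> borel_measurable borel"
    using \<psi>(1) by (rule borel_measurable_continuous_onI)
  have conth: "continuous_on A h" for A
    using h by (meson DERIV_isCont continuous_at_imp_continuous_on)
  have g: "(g has_real_derivative \<psi> (h t) * h' t) (at t)" for t
    unfolding g_def using DERIV_chain2[OF \<Psi> h] .
  have mvt_g: "\<exists>\<xi>\<in>{s..t}. \<bar>g t - g s\<bar> = \<psi> (h \<xi>) * \<bar>h' \<xi>\<bar> * (t - s)" if st: "s < t" for s t
  proof -
    obtain \<xi> where "s < \<xi>" "\<xi> < t" "g t - g s = (t - s) * (\<psi> (h \<xi>) * h' \<xi>)"
      using MVT2[OF st g] by blast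
    then show ?thesis using st \<psi>(2)[of "h \<xi>"] by (intro bexI[of _ \<xi>]) (auto simp: abs_mult)
  qed
  obtain \<zeta> where \<zeta>: "\<zeta> \<in> {l..u}" "G u - G l = (u - l) * (\<psi> (h \<zeta>) * \<bar>h' \<zeta>\<bar>)"
    using MVT2[OF lu G] by (metis atLeastAtMost_iff less_imp_le)
  have \<epsilon>: "0 \<le> \<epsilon>" using osc[of l l] lu by auto
  have sing: "emeasure ?D {y} = 0" for y
    by (subst emeasure_density_Icc[of \<psi> \<Psi> y y, simplified]) (use \<psi> \<Psi> in auto)
  have meas: "h ` {l..<u} \<in> sets ?D"
  proof -
    have "{y \<in> space (borel :: real measure). \<exists>t\<in>{l..<u}. h t - y = 0} \<in> sets borel"
      by (intro sets_has_root_Ico continuous_intros conth) auto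
    also have "{y \<in> space (borel :: real measure). \<exists>t\<in>{l..<u}. h t - y = 0} = h ` {l..<u}" by auto
    finally show ?thesis by simp
  qed
  obtain s1 where s1: "s1 \<in> {l..u}" "\<And>t. t \<in> {l..u} \<Longrightarrow> h s1 \<le> h t"
    using continuous_attains_inf[OF compact_Icc _ conth, of l u] lu
    by (metis atLeastAtMost_iff empty_iff less_imp_le order_refl)
  obtain s2 where s2: "s2 \<in> {l..u}" "\<And>t. t \<in> {l..u} \<Longrightarrow> h t \<le> h s2"
    using continuous_attains_sup[OF compact_Icc _ conth, of l u] lu
    by (metis atLeastAtMost_iff empty_iff less_imp_le order_refl)
  have "emeasure ?D (h ` {l..<u}) \<le> emeasure ?D {h s1..h s2}"
    using s1 s2 by (intro emeasure_mono) auto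
  also have "\<dots> = ennreal (g s2 - g s1)"
    unfolding g_def using s1(2)[OF s2(1)] by (intro emeasure_density_Icc \<psi> \<Psi>) auto
  finally have upper: "emeasure ?D (h ` {l..<u}) \<le> ennreal (g s2 - g s1)" .
  define r where "r = measure ?D (h ` {l..<u})"
  have r: "emeasure ?D (h ` {l..<u}) = ennreal r"
    unfolding r_def by (rule emeasure_eq_ennreal_measure) (use upper in \<open>auto simp: top_unique\<close>)
  have r0: "0 \<le> r" by (simp add: r_def)
  have gmono: "g s1 \<le> g s2"
    unfolding g_def using s1(2)[OF s2(1)] by (rule DERIV_nonneg_imp_nondecreasing) (use \<Psi> \<psi>(2) in blast)
  have "r \<le> g s2 - g s1" using upper gmono unfolding r by (simp add: ennreal_le_iff)
  also have "g s2 - g s1 \<le> (\<psi> (h \<zeta>) * \<bar>h' \<zeta>\<bar> + \<epsilon>) * (u - l)"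
  proof -
    \<comment> \<open>The minimum may be attained to the right of the maximum, so the two points are
      ordered before the mean value theorem is applied.\<close>
    let ?m = "min s1 s2" and ?M = "max s1 s2"
    show ?thesis
    proof (cases "s1 = s2")
      case True
      then show ?thesis using \<epsilon> lu \<psi>(2) by simp
    next
      case False
      then have "?m < ?M" by auto
      then obtain \<xi> where \<xi>: "\<xi> \<in> {?m..?M}" "\<bar>g ?M - g ?m\<bar> = \<psi> (h \<xi>) * \<bar>h' \<xi>\<bar> * (?M - ?m)"
        using mvt_g by blast
      have "g s2 - g s1 \<le> \<bar>g ?M - g ?m\<bar>" by (auto simp: min_def max_def)
      also have "\<dots> \<le> (\<psi> (h \<zeta>) * \<bar>h' \<zeta>\<bar> + \<epsilon>) * (u - l)"
        unfolding \<xi>(2) using \<xi>(1) s1(1) s2(1) \<psi>(2) \<epsilon> \<zeta>(1)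
        by (intro mult_mono osc) auto
      finally show ?thesis .
    qed
  qed
  finally have up: "r \<le> (\<psi> (h \<zeta>) * \<bar>h' \<zeta>\<bar> + \<epsilon>) * (u - l)" .
  have low: "\<bar>g u - g l\<bar> \<le> r"
  proof -
    let ?m = "min (h l) (h u)" and ?M = "max (h l) (h u)"
    \<comment> \<open>Leaving out the endpoint \<open>u\<close> loses at most the level
      \<open>h u\<close>, which has mass zero.\<close>
    have "{?m..?M} \<subseteq> insert (h u) (h ` {l..<u})"
    proof
      fix y assume y: "y \<in> {?m..?M}"
      have "\<exists>t\<ge>l. t \<le> u \<and> h t = y"
      proof (cases "h l \<le> h u")
        case True
        then show ?thesis using y lu conth by (intro IVT') auto
      next
        case False
        then show ?thesis using y lu conth by (intro IVT2') auto
      qed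
      then obtain t where t: "l \<le> t" "t \<le> u" "h t = y" by blast
      then show "y \<in> insert (h u) (h ` {l..<u})"
        by (cases "t = u") (auto intro!: image_eqI[of _ _ t])
    qed
    then have "emeasure ?D {?m..?M} \<le> emeasure ?D (insert (h u) (h ` {l..<u}))"
      using meas by (intro emeasure_mono) auto
    also have "\<dots> = emeasure ?D (h ` {l..<u} \<union> {h u})" by simp
    also have "\<dots> = emeasure ?D (h ` {l..<u})"
      by (intro emeasure_Un_null_set) (use meas sing in \<open>auto simp: null_sets_def\<close>)
    also have "emeasure ?D {?m..?M} = ennreal (\<Psi> ?M - \<Psi> ?m)"
      by (intro emeasure_density_Icc \<psi> \<Psi>) auto
    finally have "\<Psi> ?M - \<Psi> ?m \<le> r" unfolding r using r0 by (simp add: ennreal_le_iff)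
    moreover have "\<Psi> ?m \<le> \<Psi> ?M"
      by (rule DERIV_nonneg_imp_nondecreasing) (use \<Psi> \<psi>(2) in auto)
    ultimately show ?thesis unfolding g_def by (auto simp: min_def max_def split: if_splits)
  qed
  obtain \<xi> where \<xi>: "\<xi> \<in> {l..u}" "\<bar>g u - g l\<bar> = \<psi> (h \<xi>) * \<bar>h' \<xi>\<bar> * (u - l)" using mvt_g[OF lu] by blast
  have "\<psi> (h \<zeta>) * \<bar>h' \<zeta>\<bar> * (u - l) \<le> (\<psi> (h \<xi>) * \<bar>h' \<xi>\<bar> + \<epsilon>) * (u - l)"
    using lu by (intro mult_right_mono osc \<xi> \<zeta>) auto
  then have "\<bar>r - (G u - G l)\<bar> \<le> \<epsilon> * (u - l)"
    using up low unfolding \<zeta>(2) \<xi>(2) by (intro abs_leI) (simp_all add: algebra_simps)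
  with that r r0 show ?thesis by blast
qed

text \<open>
  The Banach indicatrix formula: each grid cell contributes the \<open>\<psi>\<close>-mass of its image under \<open>h\<close>,
  which the mean value theorem compares with the integral of \<open>\<psi> (h t) * \<bar>h' t\<bar>\<close> over that cell.
\<close>

lemma nn_integral_count_level_set:
  fixes h h' \<psi> :: "real \<Rightarrow> real"
  assumes ab: "a < b"
    and h: "\<And>t. (h has_real_derivative h' t) (at t)" and h': "continuous_on UNIV h'"
    and \<psi>: "continuous_on UNIV \<psi>" "\<And>y. 0 \<le> \<psi> y"
  shows "(\<integral>\<^sup>+y. emeasure (count_space UNIV) (roots_in (\<lambda>t. h t - y) a b) \<partial>density lborel \<psi>) =
    (\<integral>\<^sup>+t. ennreal (\<psi> (h t) * \<bar>h' t\<bar>) * indicator {a..b} t \<partial>lborel)"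
proof -
  let ?D = "density lborel \<psi>"
  let ?p = "grid_point a b"
  define f where "f t = \<psi> (h t) * \<bar>h' t\<bar>" for t
  have conth: "continuous_on A h" for A
    using h by (meson DERIV_isCont continuous_at_imp_continuous_on)
  have "continuous_on UNIV (\<lambda>t. \<psi> (h t))"
    by (rule continuous_on_compose2[OF \<psi>(1) conth]) simp
  then have contf: "continuous_on UNIV f" unfolding f_def using h' by (intro continuous_intros)
  have f0: "0 \<le> f t" for t using \<psi>(2) by (simp add: f_def)
  obtain G where G: "\<And>t. (G has_real_derivative f t) (at t)"
    using continuous_has_antiderivative[OF contf] by blast
  obtain \<Psi> where \<Psi>: "\<And>t. (\<Psi> has_real_derivative \<psi> t) (at t)"
    using continuous_has_antiderivative[OF \<psi>(1)] by blast
  have sub: "roots_in (\<lambda>t. h t - y) a b \<subseteq> {a..b}" for y by (auto simp: roots_in_def)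
  have \<psi>_meas [measurable]: "\<psi> \<in> borel_measurable borel"
    using \<psi>(1) by (rule borel_measurable_continuous_onI)
  define N where "N n y = (of_nat (card (grid_index a b n ` roots_in (\<lambda>t. h t - y) a b)) :: ennreal)" for n y
  have N_meas [measurable]: "N n \<in> borel_measurable ?D" for n
    unfolding N_def by (intro borel_measurable_card_grid_index_roots ab continuous_intros conth) auto
  have N_mono: "incseq N"
    unfolding N_def using card_grid_index_mono[OF ab sub] by (auto simp: incseq_def le_fun_def)
  have "(\<integral>\<^sup>+y. emeasure (count_space UNIV) (roots_in (\<lambda>t. h t - y) a b) \<partial>?D) = (SUP n. \<integral>\<^sup>+y. N n y \<partial>?D)"
    unfolding emeasure_count_space_eq_SUP_grid[OF ab sub] N_def[symmetric]
    by (intro nn_integral_monotone_convergence_SUP N_mono N_meas)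
  moreover have "incseq (\<lambda>n. \<integral>\<^sup>+y. N n y \<partial>?D)"
    using N_mono by (auto simp: incseq_def le_fun_def intro!: nn_integral_mono)
  ultimately have lim: "(\<lambda>n. \<integral>\<^sup>+y. N n y \<partial>?D) \<longlonglongrightarrow>
      (\<integral>\<^sup>+y. emeasure (count_space UNIV) (roots_in (\<lambda>t. h t - y) a b) \<partial>?D)"
    using LIMSEQ_SUP by metis

  have sing: "emeasure ?D {y} = 0" for y
    by (subst emeasure_density_Icc[of \<psi> \<Psi> y y, simplified]) (use \<psi> \<Psi> in auto)
  \<comment> \<open>As a function of the level, a cell contributes the indicator of its image; the
    extra cell \<open>{b}\<close> contributes only the level \<open>h b\<close>, a null set.\<close>
  have intN: "(\<integral>\<^sup>+y. N n y \<partial>?D) = (\<Sum>j<2 ^ n. emeasure ?D (h ` {?p n j..<?p n (Suc j)}))" for n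
  proof -
    have im: "(\<exists>t\<in>A. h t - y = 0) \<longleftrightarrow> y \<in> h ` A" for A y by auto
    have meas [measurable]: "h ` {?p n j..<?p n (Suc j)} \<in> sets borel" for j
    proof -
      have "{y \<in> space (borel :: real measure). \<exists>t\<in>{?p n j..<?p n (Suc j)}. h t - y = 0} \<in> sets borel"
        by (intro sets_has_root_Ico continuous_intros conth) auto
      then show ?thesis unfolding im by simp
    qed
    have "(\<integral>\<^sup>+y. N n y \<partial>?D) = (\<integral>\<^sup>+y. (\<Sum>j<2 ^ n. indicator (h ` {?p n j..<?p n (Suc j)}) y) + indicator {h b} y \<partial>?D)"
      unfolding N_def card_grid_index_roots[OF ab] im
      by (intro nn_integral_cong arg_cong2[of _ _ _ _ "(+)"] sum.cong) (auto simp: indicator_def)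
    also have "\<dots> = (\<Sum>j<2 ^ n. emeasure ?D (h ` {?p n j..<?p n (Suc j)})) + emeasure ?D {h b}"
      by (subst nn_integral_add) (auto simp: nn_integral_sum)
    finally show ?thesis using sing by simp
  qed

  have lim2: "(\<lambda>n. \<integral>\<^sup>+y. N n y \<partial>?D) \<longlonglongrightarrow> ennreal (G b - G a)"
  proof -
    define R where "R n = enn2real (\<integral>\<^sup>+y. N n y \<partial>?D)" for n
    \<comment> \<open>Uniform continuity of \<open>f\<close> makes its oscillation on every cell at
      most \<open>\<epsilon>\<close> once the mesh is small. The increments of \<open>G\<close>
      telescope, and the errors of the \<open>2 ^ n\<close> cells add up to
      \<open>\<epsilon> * (b - a)\<close>.\<close>
    have ev: "\<forall>\<^sub>F n in sequentially. (\<integral>\<^sup>+y. N n y \<partial>?D) = ennreal (R n) \<and> \<bar>R n - (G b - G a)\<bar> \<le> \<epsilon> * (b - a)"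
      if "\<epsilon> > 0" for \<epsilon>
    proof -
      have "uniformly_continuous_on {a..b} f"
        using contf by (intro compact_uniformly_continuous) (auto intro: continuous_on_subset)
      then obtain \<delta> where \<delta>: "\<delta> > 0" "\<And>s t. s \<in> {a..b} \<Longrightarrow> t \<in> {a..b} \<Longrightarrow> dist s t < \<delta> \<Longrightarrow> dist (f s) (f t) < \<epsilon>"
        using \<open>\<epsilon> > 0\<close> unfolding uniformly_continuous_on_def by metis
      obtain k where k: "(b - a) / \<delta> < 2 ^ k" using real_arch_pow[of 2 "(b - a) / \<delta>"] by auto
      show ?thesis unfolding eventually_sequentially
      proof (intro exI allI impI)
        fix n assume "n \<ge> k"
        then have "(b - a) / 2 ^ n \<le> (b - a) / 2 ^ k"
          using ab by (intro divide_left_mono) auto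
        also have "\<dots> < \<delta>" using k \<delta>(1) by (simp add: field_simps)
        finally have mesh: "(b - a) / 2 ^ n < \<delta>" .
        have "\<exists>r\<ge>0. emeasure ?D (h ` {?p n j..<?p n (Suc j)}) = ennreal r \<and>
            \<bar>r - (G (?p n (Suc j)) - G (?p n j))\<bar> \<le> \<epsilon> * ((b - a) / 2 ^ n)" if j: "j < 2 ^ n" for j
        proof -
          let ?l = "?p n j" and ?u = "?p n (Suc j)"
          have d: "?u - ?l = (b - a) / 2 ^ n" by (rule grid_point_diff)
          then have lu: "?l < ?u" using ab by (metis diff_gt_0_iff_gt divide_pos_pos zero_less_numeral zero_less_power)
          have "a \<le> ?l" "?u \<le> b" using grid_point_bounds[OF ab] j by auto
          then have "f s \<le> f t + \<epsilon>" if st: "s \<in> {?l..?u}" "t \<in> {?l..?u}" for s t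
          proof -
            have "\<bar>s - t\<bar> \<le> ?u - ?l" using st by auto
            then have "dist s t < \<delta>" using mesh unfolding d dist_real_def by linarith
            moreover have "s \<in> {a..b}" "t \<in> {a..b}" using st \<open>a \<le> ?l\<close> \<open>?u \<le> b\<close> by auto
            ultimately have "dist (f s) (f t) < \<epsilon>" using \<delta>(2) by blast
            then show ?thesis by (simp add: dist_real_def)
          qed
          then obtain r where "0 \<le> r" "emeasure ?D (h ` {?l..<?u}) = ennreal r" "\<bar>r - (G ?u - G ?l)\<bar> \<le> \<epsilon> * (?u - ?l)"
            using image_cell_measure_bounds[OF h \<psi> \<Psi> G[unfolded f_def] lu] unfolding f_def by metis
          then show ?thesis unfolding d by auto
        qed
        then obtain r where r: "\<And>j. j < 2 ^ n \<Longrightarrow> 0 \<le> r j"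
            "\<And>j. j < 2 ^ n \<Longrightarrow> emeasure ?D (h ` {?p n j..<?p n (Suc j)}) = ennreal (r j)"
            "\<And>j. j < 2 ^ n \<Longrightarrow> \<bar>r j - (G (?p n (Suc j)) - G (?p n j))\<bar> \<le> \<epsilon> * ((b - a) / 2 ^ n)"
          by metis
        have "(\<integral>\<^sup>+y. N n y \<partial>?D) = (\<Sum>j<2 ^ n. ennreal (r j))" unfolding intN using r(2) by simp
        also have "\<dots> = ennreal (\<Sum>j<2 ^ n. r j)" using r(1) by (intro sum_ennreal) auto
        finally have *: "(\<integral>\<^sup>+y. N n y \<partial>?D) = ennreal (\<Sum>j<2 ^ n. r j)" .
        then have Rn: "R n = (\<Sum>j<2 ^ n. r j)" unfolding R_def using r(1) by (metis enn2real_ennreal lessThan_iff sum_nonneg)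
        have "G b - G a = (\<Sum>j<2 ^ n. G (?p n (Suc j)) - G (?p n j))"
          by (subst sum_lessThan_telescope) simp
        then have "\<bar>R n - (G b - G a)\<bar> = \<bar>\<Sum>j<2 ^ n. r j - (G (?p n (Suc j)) - G (?p n j))\<bar>"
          unfolding Rn by (simp add: sum_subtractf)
        also have "\<dots> \<le> (\<Sum>j<2 ^ n. \<bar>r j - (G (?p n (Suc j)) - G (?p n j))\<bar>)" by (rule sum_abs)
        also have "\<dots> \<le> (\<Sum>j<(2::nat) ^ n. \<epsilon> * ((b - a) / 2 ^ n))" using r(3) by (intro sum_mono) auto
        also have "\<dots> = \<epsilon> * (b - a)" by simp
        finally show "(\<integral>\<^sup>+y. N n y \<partial>?D) = ennreal (R n) \<and> \<bar>R n - (G b - G a)\<bar> \<le> \<epsilon> * (b - a)"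
          using * Rn by simp
      qed
    qed
    have "R \<longlonglongrightarrow> G b - G a"
    proof (rule tendstoI)
      fix e :: real assume "e > 0"
      then have "e / (2 * (b - a)) > 0" using ab by simp
      from ev[OF this] show "\<forall>\<^sub>F n in sequentially. dist (R n) (G b - G a) < e"
      proof (rule eventually_mono)
        fix n assume "(\<integral>\<^sup>+y. N n y \<partial>?D) = ennreal (R n) \<and> \<bar>R n - (G b - G a)\<bar> \<le> e / (2 * (b - a)) * (b - a)"
        moreover have "e / (2 * (b - a)) * (b - a) = e / 2" using ab by (simp add: field_simps)
        ultimately show "dist (R n) (G b - G a) < e"
          using \<open>e > 0\<close> unfolding dist_real_def by linarith
      qed
    qed
    then have "(\<lambda>n. ennreal (R n)) \<longlonglongrightarrow> ennreal (G b - G a)" by (rule tendsto_ennrealI)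
    \<comment> \<open>\<open>ev\<close> with any tolerance also shows that the integrals are
      eventually finite, so \<open>enn2real\<close> in \<open>R\<close> loses nothing.\<close>
    then show ?thesis
      by (rule Lim_transform_eventually) (use ev[of 1] in \<open>auto elim: eventually_mono\<close>)
  qed
  have "(\<integral>\<^sup>+t. ennreal (f t) * indicator {a..b} t \<partial>lborel) = ennreal (G b - G a)"
    using contf G f0 ab by (intro nn_integral_FTC_Icc borel_measurable_continuous_onI) auto
  then show ?thesis using LIMSEQ_unique[OF lim lim2] by (simp add: f_def)
qed

section \<open>Gaussian integrals\<close>

abbreviation std_gauss :: "real measure" where
  "std_gauss \<equiv> density lborel (\<lambda>x. ennreal (std_normal_density x))"

lemma prob_space_std_gauss: "prob_space std_gauss"
  by (rule prob_space_normal_density) simp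

lemma nn_integral_std_gauss:
  assumes [measurable]: "f \<in> borel_measurable borel"
  shows "(\<integral>\<^sup>+x. f x \<partial>std_gauss) = (\<integral>\<^sup>+x. f x * ennreal (std_normal_density x) \<partial>lborel)"
  by (subst nn_integral_density) (auto simp: mult.commute)

lemma nn_integral_normal_density:
  assumes [measurable]: "f \<in> borel_measurable borel" and "0 < \<tau>"
  shows "(\<integral>\<^sup>+x. f x * ennreal (normal_density \<mu> \<tau> x) \<partial>lborel) = (\<integral>\<^sup>+x. f (\<mu> + \<tau> * x) \<partial>std_gauss)"
proof -
  have "normal_density \<mu> \<tau> (\<mu> + \<tau> * x) = std_normal_density x / \<tau>" for x
    using assms(2) by (simp add: normal_density_def real_sqrt_mult field_simps power2_eq_square)
  then have "ennreal \<tau> * ennreal (normal_density \<mu> \<tau> (\<mu> + \<tau> * x)) = ennreal (std_normal_density x)" for x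
    using assms(2) by (simp add: ennreal_mult[symmetric])
  then have *: "ennreal \<tau> * (f (\<mu> + \<tau> * x) * ennreal (normal_density \<mu> \<tau> (\<mu> + \<tau> * x))) =
      f (\<mu> + \<tau> * x) * ennreal (std_normal_density x)" for x
    by (metis mult.left_commute)
  have "(\<integral>\<^sup>+x. f x * ennreal (normal_density \<mu> \<tau> x) \<partial>lborel) =
      ennreal \<tau> * (\<integral>\<^sup>+x. f (\<mu> + \<tau> * x) * ennreal (normal_density \<mu> \<tau> (\<mu> + \<tau> * x)) \<partial>lborel)"
    using assms(2) by (subst nn_integral_real_affine[of _ \<tau> \<mu>]) auto
  also have "\<dots> = (\<integral>\<^sup>+x. f (\<mu> + \<tau> * x) * ennreal (std_normal_density x) \<partial>lborel)"
    unfolding *[symmetric] by (subst nn_integral_cmult) auto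
  also have "\<dots> = (\<integral>\<^sup>+x. f (\<mu> + \<tau> * x) \<partial>std_gauss)"
    by (subst nn_integral_std_gauss) auto
  finally show ?thesis .
qed

text \<open>
  Bayes' rule for a Gaussian prior on \<open>z\<close> and the observation \<open>B + y * z\<close> with noise variance \<open>S\<close>:
  evidence times posterior.
\<close>

lemma normal_density_mult_std_normal_density:
  assumes "0 < S"
  shows "normal_density 0 (sqrt S) (B + y * z) * std_normal_density z =
    normal_density 0 (sqrt (S + y\<^sup>2)) B * normal_density (- (y * B) / (S + y\<^sup>2)) (sqrt (S / (S + y\<^sup>2))) z"
proof -
  define T where "T = S + y\<^sup>2"
  have T: "0 < T" using assms unfolding T_def by (smt (verit) zero_le_power2)
  have root: "sqrt (2 * pi * T) * sqrt (2 * pi * (S / T)) = sqrt (2 * pi * S) * sqrt (2 * pi)"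
    using T assms by (simp add: real_sqrt_mult[symmetric])
  have y2: "y\<^sup>2 = T - S" by (simp add: T_def)
  \<comment> \<open>Completing the square in \<open>z\<close>. Here \<open>T\<close> is the variance
    of the observation, noise plus signal, and \<open>S / T\<close> the posterior variance.\<close>
  have expo: "(B + y * z)\<^sup>2 / (2 * S) + z\<^sup>2 / 2 = B\<^sup>2 / (2 * T) + (z - - (y * B) / T)\<^sup>2 / (2 * (S / T))"
  proof -
    have "T * ((B + y * z)\<^sup>2 + S * z\<^sup>2) = B\<^sup>2 * S + (T * z + y * B)\<^sup>2"
      unfolding T_def by algebra
    then show ?thesis using T assms
      by (simp add: divide_simps power2_eq_square) (simp add: algebra_simps)
  qed
  have "normal_density 0 (sqrt S) (B + y * z) * std_normal_density z =
      1 / (sqrt (2 * pi * S) * sqrt (2 * pi)) * exp (- ((B + y * z)\<^sup>2 / (2 * S) + z\<^sup>2 / 2))"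
    using assms by (simp add: normal_density_def mult_exp_exp)
  also have "\<dots> = 1 / (sqrt (2 * pi * T) * sqrt (2 * pi * (S / T))) *
      exp (- (B\<^sup>2 / (2 * T) + (z - - (y * B) / T)\<^sup>2 / (2 * (S / T))))"
    unfolding root expo ..
  also have "\<dots> = normal_density 0 (sqrt T) B * normal_density (- (y * B) / T) (sqrt (S / T)) z"
    using assms T by (simp add: normal_density_def mult_exp_exp)
  finally show ?thesis unfolding T_def .
qed

lemma nn_integral_std_gauss_reflect:
  assumes [measurable]: "f \<in> borel_measurable borel"
  shows "(\<integral>\<^sup>+z. f (- z) \<partial>std_gauss) = (\<integral>\<^sup>+z. f z \<partial>std_gauss)"
proof -
  have "std_normal_density (- x) = std_normal_density x" for x by (simp add: normal_density_def)
  then show ?thesis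
    using nn_integral_real_affine[of "\<lambda>x. f x * ennreal (std_normal_density x)" "-1" 0]
    by (simp add: nn_integral_std_gauss)
qed

text \<open>Linear coefficients may be negative or come as square roots of squares, while a normal
  density takes a positive standard deviation; the symmetry of the Gaussian bridges the gap.\<close>

lemma nn_integral_std_gauss_scale:
  assumes [measurable]: "f \<in> borel_measurable borel" and "\<bar>s\<bar> = \<bar>s'\<bar>"
  shows "(\<integral>\<^sup>+z. f (\<mu> + s * z) \<partial>std_gauss) = (\<integral>\<^sup>+z. f (\<mu> + s' * z) \<partial>std_gauss)"
proof -
  consider "s = s'" | "s = - s'" using assms(2) by linarith
  then show ?thesis
  proof cases
    case 2
    then show ?thesis using nn_integral_std_gauss_reflect[of "\<lambda>z. f (\<mu> + s' * z)"] by simp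
  qed simp
qed

text \<open>Variances of independent normal variables add. This is read off from Bayes' rule with
  \<open>s * u\<close> as noise: integrating over \<open>z\<close> removes the posterior, a
  probability density, and leaves the evidence. For \<open>s = 0\<close> there is no noise density
  to factor.\<close>

lemma nn_integral_std_gauss_add:
  assumes f [measurable]: "f \<in> borel_measurable borel"
  shows "(\<integral>\<^sup>+z. (\<integral>\<^sup>+u. f (\<mu> + b * z + s * u) \<partial>std_gauss) \<partial>std_gauss) =
    (\<integral>\<^sup>+u. f (\<mu> + sqrt (s\<^sup>2 + b\<^sup>2) * u) \<partial>std_gauss)"
proof (cases "s = 0")
  case True
  interpret prob_space std_gauss by (rule prob_space_std_gauss)
  show ?thesis using True nn_integral_std_gauss_scale[OF f, of b "\<bar>b\<bar>"] emeasure_space_1 by simp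
next
  case False
  let ?T = "s\<^sup>2 + b\<^sup>2"
  have T: "0 < ?T" using False by (simp add: sum_power2_gt_zero_iff)
  have [simp]: "0 < s\<^sup>2" using False by simp
  have abs: "(\<integral>\<^sup>+u. f (\<mu> + b * z + s * u) \<partial>std_gauss) =
      (\<integral>\<^sup>+x. f x * ennreal (normal_density (\<mu> + b * z) \<bar>s\<bar> x) \<partial>lborel)" for z
    using False by (subst nn_integral_normal_density) (auto intro: nn_integral_std_gauss_scale)
  \<comment> \<open>Moves the mean into the argument, which gives the density the form of the
    likelihood in Bayes' rule.\<close>
  have shift: "normal_density (\<mu> + b * z) \<bar>s\<bar> x = normal_density 0 (sqrt (s\<^sup>2)) ((\<mu> - x) + b * z)" for z x
    by (simp add: normal_density_def power2_commute add_diff_eq algebra_simps)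
  have "(\<integral>\<^sup>+z. (\<integral>\<^sup>+u. f (\<mu> + b * z + s * u) \<partial>std_gauss) \<partial>std_gauss) =
      (\<integral>\<^sup>+z. (\<integral>\<^sup>+x. f x * ennreal (normal_density (\<mu> + b * z) \<bar>s\<bar> x * std_normal_density z) \<partial>lborel) \<partial>lborel)"
    unfolding abs
    apply (subst nn_integral_std_gauss)
    subgoal by (simp add: normal_density_def)
    apply (subst nn_integral_multc[symmetric])
    by (auto simp: ennreal_mult mult.assoc)
  also have "\<dots> = (\<integral>\<^sup>+x. (\<integral>\<^sup>+z. f x * ennreal (normal_density (\<mu> + b * z) \<bar>s\<bar> x * std_normal_density z) \<partial>lborel) \<partial>lborel)"
    by (rule lborel_pair.Fubini') (simp add: normal_density_def)
  also have "\<dots> = (\<integral>\<^sup>+x. f x * ennreal (normal_density \<mu> (sqrt ?T) x) \<partial>lborel)"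
  proof (rule nn_integral_cong)
    fix x
    let ?n = "normal_density (- (b * (\<mu> - x)) / ?T) (sqrt (s\<^sup>2 / ?T))"
    have *: "normal_density (\<mu> + b * z) \<bar>s\<bar> x * std_normal_density z =
        normal_density 0 (sqrt ?T) (\<mu> - x) * ?n z" for z
      unfolding shift by (rule normal_density_mult_std_normal_density) (use False in simp)
    have one: "(\<integral>\<^sup>+z. ennreal (?n z) \<partial>lborel) = 1"
      using T False by (subst nn_integral_eq_integral) auto
    have "(\<integral>\<^sup>+z. f x * ennreal (normal_density (\<mu> + b * z) \<bar>s\<bar> x * std_normal_density z) \<partial>lborel) =
        (\<integral>\<^sup>+z. (f x * ennreal (normal_density 0 (sqrt ?T) (\<mu> - x))) * ennreal (?n z) \<partial>lborel)"
      unfolding * by (simp add: ennreal_mult mult.assoc)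
    also have "\<dots> = f x * ennreal (normal_density 0 (sqrt ?T) (\<mu> - x))"
      by (subst nn_integral_cmult) (measurable, simp only: one mult_1_right)
    also have "normal_density 0 (sqrt ?T) (\<mu> - x) = normal_density \<mu> (sqrt ?T) x"
      by (simp add: normal_density_def power2_commute)
    finally show "(\<integral>\<^sup>+z. f x * ennreal (normal_density (\<mu> + b * z) \<bar>s\<bar> x * std_normal_density z) \<partial>lborel) =
        f x * ennreal (normal_density \<mu> (sqrt ?T) x)" .
  qed
  also have "\<dots> = (\<integral>\<^sup>+u. f (\<mu> + sqrt ?T * u) \<partial>std_gauss)"
    using T by (intro nn_integral_normal_density f) simp
  finally show ?thesis .
qed

text \<open>Cauchy-Schwarz with room to spare from the noise variance \<open>1\<close>. The quantity
  is the variance of \<open>\<Sum>i\<in>I. x i * e i\<close> given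
  \<open>\<Sum>i\<in>I. y i * e i\<close> plus unit noise, for independent standard normal
  \<open>e i\<close>.\<close>

lemma gauss_conditional_variance_nonneg:
  fixes x y :: "'i \<Rightarrow> real"
  shows "0 \<le> (\<Sum>i\<in>I. (x i)\<^sup>2) - (\<Sum>i\<in>I. x i * y i)\<^sup>2 / (1 + (\<Sum>i\<in>I. (y i)\<^sup>2))"
proof -
  let ?Q = "\<Sum>i\<in>I. (x i)\<^sup>2" and ?R = "\<Sum>i\<in>I. (y i)\<^sup>2"
  have "(\<Sum>i\<in>I. x i * y i)\<^sup>2 \<le> ?Q * ?R" by (rule Cauchy_Schwarz_ineq_sum)
  also have "\<dots> \<le> ?Q * (1 + ?R)" by (intro mult_left_mono) (auto intro: sum_nonneg)
  finally show ?thesis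
    using sum_nonneg[of I "\<lambda>i. (y i)\<^sup>2"] by (simp add: divide_le_eq)
qed

text \<open>
  Integrates out the coordinates one at a time; \<open>S\<close>, \<open>c\<close> and \<open>v\<close> below are updated as in a Kalman filter.
\<close>

lemma nn_integral_PiM_std_gauss_normal_density:
  fixes x y :: "'i \<Rightarrow> real" and I :: "'i set" and f :: "real \<Rightarrow> ennreal"
  defines "S \<equiv> (\<lambda>I. 1 + (\<Sum>i\<in>I. (y i)\<^sup>2))"
  defines "c \<equiv> (\<lambda>I. (\<Sum>i\<in>I. x i * y i) / S I)"
  defines "v \<equiv> (\<lambda>I. (\<Sum>i\<in>I. (x i)\<^sup>2) - (\<Sum>i\<in>I. x i * y i)\<^sup>2 / S I)"
  assumes f [measurable]: "f \<in> borel_measurable borel" and I: "finite I"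
  shows "(\<integral>\<^sup>+e. f (A + (\<Sum>i\<in>I. x i * e i)) * ennreal (std_normal_density (B + (\<Sum>i\<in>I. y i * e i))) \<partial>(\<Pi>\<^sub>M i\<in>I. std_gauss)) =
    ennreal (normal_density 0 (sqrt (S I)) B) * (\<integral>\<^sup>+u. f (A - c I * B + sqrt (v I) * u) \<partial>std_gauss)"
  using I
\<comment> \<open>Freezing a coordinate shifts both offsets, so the induction carries general
  \<open>A\<close> and \<open>B\<close>, although zero offsets are what is wanted in the
  end.\<close>
proof (induction I arbitrary: A B)
  case empty
  interpret prob_space std_gauss by (rule prob_space_std_gauss)
  interpret product_sigma_finite "\<lambda>_. std_gauss"
    by unfold_locales
  show ?case using emeasure_space_1
    by (simp add: PiM_empty nn_integral_count_space_finite S_def c_def v_def mult.commute)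
next
  case (insert i I)
  interpret prob_space std_gauss by (rule prob_space_std_gauss)
  interpret product_sigma_finite "\<lambda>_. std_gauss"
    by unfold_locales
  let ?T = "S (insert i I)"
  have S: "0 < S I" unfolding S_def by (smt (verit) sum_nonneg zero_le_power2)
  have T: "?T = S I + (y i)\<^sup>2" unfolding S_def using insert.hyps by simp
  have T0: "0 < ?T" using S unfolding T by (smt (verit) zero_le_power2)
  \<comment> \<open>\<open>?m\<close> and \<open>?\<tau>\<close> are the posterior mean and standard
    deviation of coordinate \<open>i\<close>; \<open>?k\<close> is its coefficient in the argument
    of \<open>f\<close> after the regression correction by \<open>c I\<close>.\<close>
  let ?m = "- (y i * B) / ?T" and ?\<tau> = "sqrt (S I / ?T)" and ?k = "x i - c I * y i"
  have c': "c (insert i I) = c I + ?k * y i / ?T"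
  proof -
    have "(\<Sum>j\<in>insert i I. x j * y j) = c I * S I + x i * y i"
      using insert.hyps S by (simp add: c_def)
    moreover have "c (insert i I) = (\<Sum>j\<in>insert i I. x j * y j) / ?T" by (simp add: c_def)
    ultimately show ?thesis using T0
      by (simp add: field_simps) (simp add: T power2_eq_square algebra_simps)
  qed
  \<comment> \<open>The posterior spread of the new coordinate, scaled by \<open>?k\<close>, is
    independent of the residual left by the others, so its variance is added.\<close>
  have v': "v (insert i I) = v I + (?k * ?\<tau>)\<^sup>2"
  proof -
    define P Q where "P = (\<Sum>j\<in>I. x j * y j)" and "Q = (\<Sum>j\<in>I. (x j)\<^sup>2)"
    have "(?k * ?\<tau>)\<^sup>2 = ?k\<^sup>2 * (S I / ?T)"
      using S T0 by (simp add: power_mult_distrib)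
    also have "\<dots> = (x i * S I - P * y i)\<^sup>2 / (S I * ?T)"
      using S T0 unfolding c_def P_def[symmetric] by (simp add: field_simps power2_eq_square)
    finally have *: "v I + (?k * ?\<tau>)\<^sup>2 = Q - P\<^sup>2 / S I + (x i * S I - P * y i)\<^sup>2 / (S I * ?T)"
      unfolding v_def P_def[symmetric] Q_def[symmetric] by simp
    have "v (insert i I) = Q + (x i)\<^sup>2 - (P + x i * y i)\<^sup>2 / ?T"
      unfolding v_def P_def Q_def using insert.hyps by (simp add: add.commute)
    also have "\<dots> = Q - P\<^sup>2 / S I + (x i * S I - P * y i)\<^sup>2 / (S I * ?T)"
    proof -
      have "(x i)\<^sup>2 * S I * ?T - (P + x i * y i)\<^sup>2 * S I = (x i * S I - P * y i)\<^sup>2 - P\<^sup>2 * ?T"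
        unfolding T by algebra
      then have "((x i)\<^sup>2 * S I * ?T - (P + x i * y i)\<^sup>2 * S I) / (S I * ?T) =
          ((x i * S I - P * y i)\<^sup>2 - P\<^sup>2 * ?T) / (S I * ?T)" by simp
      then show ?thesis using S T0 by (simp add: diff_divide_distrib)
    qed
    finally show ?thesis using * by simp
  qed
  have v0: "0 \<le> v I" unfolding v_def S_def by (rule gauss_conditional_variance_nonneg)
  have "(\<integral>\<^sup>+e. f (A + (\<Sum>j\<in>insert i I. x j * e j)) * ennreal (std_normal_density (B + (\<Sum>j\<in>insert i I. y j * e j)))
        \<partial>(\<Pi>\<^sub>M i\<in>insert i I. std_gauss)) =
      (\<integral>\<^sup>+z. (\<integral>\<^sup>+e. f (A + (\<Sum>j\<in>insert i I. x j * (e(i := z)) j)) *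
        ennreal (std_normal_density (B + (\<Sum>j\<in>insert i I. y j * (e(i := z)) j))) \<partial>(\<Pi>\<^sub>M i\<in>I. std_gauss)) \<partial>std_gauss)"
    using insert.hyps by (intro product_nn_integral_insert_rev) measurable
  also have "\<dots> = (\<integral>\<^sup>+z. (\<integral>\<^sup>+e. f ((A + x i * z) + (\<Sum>j\<in>I. x j * e j)) *
        ennreal (std_normal_density ((B + y i * z) + (\<Sum>j\<in>I. y j * e j))) \<partial>(\<Pi>\<^sub>M i\<in>I. std_gauss)) \<partial>std_gauss)"
  proof -
    have "(\<Sum>j\<in>insert i I. w j * (e(i := z)) j) = w i * z + (\<Sum>j\<in>I. w j * e j)" for w e :: "'i \<Rightarrow> real" and z
      using insert.hyps by (subst sum.insert) (auto intro!: sum.cong)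
    then show ?thesis by (simp only: add.assoc)
  qed
  also have "\<dots> = (\<integral>\<^sup>+z. ennreal (normal_density 0 (sqrt (S I)) (B + y i * z)) *
        (\<integral>\<^sup>+u. f ((A + x i * z) - c I * (B + y i * z) + sqrt (v I) * u) \<partial>std_gauss) \<partial>std_gauss)"
    unfolding insert.IH ..
  also have "\<dots> = (\<integral>\<^sup>+z. ennreal (normal_density 0 (sqrt ?T) B) *
        ((\<integral>\<^sup>+u. f (A - c I * B + ?k * z + sqrt (v I) * u) \<partial>std_gauss) * ennreal (normal_density ?m ?\<tau> z)) \<partial>lborel)"
  proof (subst nn_integral_std_gauss)
    show "(\<lambda>z. ennreal (normal_density 0 (sqrt (S I)) (B + y i * z)) *
        (\<integral>\<^sup>+u. f ((A + x i * z) - c I * (B + y i * z) + sqrt (v I) * u) \<partial>std_gauss)) \<in> borel_measurable borel"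
      by measurable
    have arg: "(A + x i * z) - c I * (B + y i * z) + sqrt (v I) * u = A - c I * B + ?k * z + sqrt (v I) * u" for z u
      by (simp add: algebra_simps)
    have dens: "ennreal (normal_density 0 (sqrt (S I)) (B + y i * z)) * ennreal (std_normal_density z) =
        ennreal (normal_density 0 (sqrt ?T) B) * ennreal (normal_density ?m ?\<tau> z)" for z
      using normal_density_mult_std_normal_density[OF S, of B "y i" z] unfolding T
      by (simp add: ennreal_mult[symmetric])
    show "(\<integral>\<^sup>+z. ennreal (normal_density 0 (sqrt (S I)) (B + y i * z)) *
        (\<integral>\<^sup>+u. f ((A + x i * z) - c I * (B + y i * z) + sqrt (v I) * u) \<partial>std_gauss) * ennreal (std_normal_density z) \<partial>lborel) =
      (\<integral>\<^sup>+z. ennreal (normal_density 0 (sqrt ?T) B) *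
        ((\<integral>\<^sup>+u. f (A - c I * B + ?k * z + sqrt (v I) * u) \<partial>std_gauss) * ennreal (normal_density ?m ?\<tau> z)) \<partial>lborel)"
      unfolding arg
    proof (rule nn_integral_cong)
      fix z
      let ?J = "\<integral>\<^sup>+u. f (A - c I * B + ?k * z + sqrt (v I) * u) \<partial>std_gauss"
      have "ennreal (normal_density 0 (sqrt (S I)) (B + y i * z)) * ?J * ennreal (std_normal_density z) =
          (ennreal (normal_density 0 (sqrt (S I)) (B + y i * z)) * ennreal (std_normal_density z)) * ?J"
        by (simp only: mult.assoc mult.commute[of ?J])
      also have "\<dots> = ennreal (normal_density 0 (sqrt ?T) B) * (?J * ennreal (normal_density ?m ?\<tau> z))"
        unfolding dens by (simp only: mult.assoc mult.commute[of ?J])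
      finally show "ennreal (normal_density 0 (sqrt (S I)) (B + y i * z)) * ?J * ennreal (std_normal_density z) =
          ennreal (normal_density 0 (sqrt ?T) B) * (?J * ennreal (normal_density ?m ?\<tau> z))" .
    qed
  qed
  also have "\<dots> = ennreal (normal_density 0 (sqrt ?T) B) *
      (\<integral>\<^sup>+z. (\<integral>\<^sup>+u. f (A - c I * B + ?k * z + sqrt (v I) * u) \<partial>std_gauss) * ennreal (normal_density ?m ?\<tau> z) \<partial>lborel)"
    by (rule nn_integral_cmult) measurable
  also have "(\<integral>\<^sup>+z. (\<integral>\<^sup>+u. f (A - c I * B + ?k * z + sqrt (v I) * u) \<partial>std_gauss) * ennreal (normal_density ?m ?\<tau> z) \<partial>lborel) =
      (\<integral>\<^sup>+z. (\<integral>\<^sup>+u. f (A - c I * B + ?k * (?m + ?\<tau> * z) + sqrt (v I) * u) \<partial>std_gauss) \<partial>std_gauss)"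
    using S T0 by (intro nn_integral_normal_density) auto
  also have "\<dots> = (\<integral>\<^sup>+z. (\<integral>\<^sup>+u. f ((A - c I * B + ?k * ?m) + (?k * ?\<tau>) * z + sqrt (v I) * u) \<partial>std_gauss) \<partial>std_gauss)"
    by (simp only: distrib_left add.assoc mult.assoc)
  \<comment> \<open>The posterior spread \<open>z\<close> and the earlier residual \<open>u\<close>
    merge into a single normal variable.\<close>
  also have "\<dots> = (\<integral>\<^sup>+u. f ((A - c I * B + ?k * ?m) + sqrt ((sqrt (v I))\<^sup>2 + (?k * ?\<tau>)\<^sup>2) * u) \<partial>std_gauss)"
    by (rule nn_integral_std_gauss_add) measurable
  also have "(sqrt (v I))\<^sup>2 + (?k * ?\<tau>)\<^sup>2 = v (insert i I)" using v0 v' by simp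
  also have "A - c I * B + ?k * ?m = A - c (insert i I) * B"
    unfolding c' by (simp add: algebra_simps)
  finally show ?case .
qed

lemma nn_integral_std_gauss_abs:
  assumes "0 \<le> s"
  shows "(\<integral>\<^sup>+u. ennreal \<bar>s * u\<bar> \<partial>std_gauss) = ennreal (s * sqrt (2 / pi))"
proof -
  have "has_bochner_integral lborel (\<lambda>x. std_normal_density x * \<bar>x\<bar>) (sqrt (2 / pi))"
    using std_normal_moment_abs_odd[of 0] by simp
  then have *: "(\<integral>\<^sup>+x. ennreal (std_normal_density x * \<bar>x\<bar>) \<partial>lborel) = ennreal (sqrt (2 / pi))"
    by (subst nn_integral_eq_integral) (auto simp: has_bochner_integral_iff)
  have "(\<integral>\<^sup>+u. ennreal \<bar>s * u\<bar> \<partial>std_gauss) = (\<integral>\<^sup>+x. ennreal s * ennreal (std_normal_density x * \<bar>x\<bar>) \<partial>lborel)"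
    using assms by (subst nn_integral_std_gauss)
      (auto simp: ennreal_mult[symmetric] abs_mult mult.assoc mult.commute intro!: nn_integral_cong)
  also have "\<dots> = ennreal s * (\<integral>\<^sup>+x. ennreal (std_normal_density x * \<bar>x\<bar>) \<partial>lborel)"
    by (rule nn_integral_cmult) measurable
  finally show ?thesis using assms * by (simp add: ennreal_mult)
qed

text \<open>With zero offsets, the evidence \<open>1 / sqrt (2 * pi * S)\<close> is multiplied by
  the absolute moment \<open>sqrt v * sqrt (2 / pi)\<close>. This product is the origin of the
  factor \<open>1 / pi\<close> in the theorem.\<close>

lemma nn_integral_std_normal_density_mult_abs:
  fixes x y :: "'i \<Rightarrow> real" and I :: "'i set"
  defines "S \<equiv> 1 + (\<Sum>i\<in>I. (y i)\<^sup>2)"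
  assumes "finite I"
  shows "(\<integral>\<^sup>+e. ennreal (std_normal_density (\<Sum>i\<in>I. y i * e i) * \<bar>\<Sum>i\<in>I. x i * e i\<bar>) \<partial>(\<Pi>\<^sub>M i\<in>I. std_gauss)) =
    ennreal (1 / pi * sqrt (S * (\<Sum>i\<in>I. (x i)\<^sup>2) - (\<Sum>i\<in>I. x i * y i)\<^sup>2) / S)"
proof -
  define v where "v = (\<Sum>i\<in>I. (x i)\<^sup>2) - (\<Sum>i\<in>I. x i * y i)\<^sup>2 / S"
  have S: "0 < S" unfolding S_def by (smt (verit) sum_nonneg zero_le_power2)
  have v0: "0 \<le> v" unfolding v_def S_def by (rule gauss_conditional_variance_nonneg)
  have "(\<integral>\<^sup>+e. ennreal (std_normal_density (\<Sum>i\<in>I. y i * e i) * \<bar>\<Sum>i\<in>I. x i * e i\<bar>) \<partial>(\<Pi>\<^sub>M i\<in>I. std_gauss)) =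
      (\<integral>\<^sup>+e. ennreal \<bar>0 + (\<Sum>i\<in>I. x i * e i)\<bar> * ennreal (std_normal_density (0 + (\<Sum>i\<in>I. y i * e i))) \<partial>(\<Pi>\<^sub>M i\<in>I. std_gauss))"
    by (simp add: ennreal_mult mult.commute)
  also have "\<dots> = ennreal (normal_density 0 (sqrt S) 0) * (\<integral>\<^sup>+u. ennreal \<bar>sqrt v * u\<bar> \<partial>std_gauss)"
    using assms(2) by (subst nn_integral_PiM_std_gauss_normal_density) (auto simp: S_def v_def)
  also have "\<dots> = ennreal (normal_density 0 (sqrt S) 0 * (sqrt v * sqrt (2 / pi)))"
    using v0 by (simp add: nn_integral_std_gauss_abs ennreal_mult)
  also have "normal_density 0 (sqrt S) 0 * (sqrt v * sqrt (2 / pi)) = 1 / pi * (sqrt v / sqrt S)"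
  proof -
    have "sqrt (2 / pi) / sqrt (2 * pi * S) = 1 / (pi * sqrt S)"
      using S by (simp add: real_sqrt_mult real_sqrt_divide field_simps)
    then have "sqrt v * (sqrt (2 / pi) / sqrt (2 * pi * S)) = sqrt v * (1 / (pi * sqrt S))" by (rule arg_cong)
    then show ?thesis using S by (simp add: normal_density_def)
  qed
  also have "sqrt v / sqrt S = sqrt (S * (\<Sum>i\<in>I. (x i)\<^sup>2) - (\<Sum>i\<in>I. x i * y i)\<^sup>2) / S"
  proof -
    have "S * (\<Sum>i\<in>I. (x i)\<^sup>2) - (\<Sum>i\<in>I. x i * y i)\<^sup>2 = S * v" using S by (simp add: v_def right_diff_distrib)
    then show ?thesis using S by (simp add: real_sqrt_mult field_simps)
  qed
  finally show ?thesis by simp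
qed

section \<open>Random trigonometric polynomials\<close>

lemma sum_reverse_weights:
  fixes f :: "nat \<Rightarrow> 'b::comm_monoid_add"
  shows "(\<Sum>k=1..m. f k) = (\<Sum>i<m. f (m - i))"
  by (rule sum.reindex_bij_witness[of _ "\<lambda>i. m - i" "\<lambda>k. m - k"]) auto

text \<open>\<open>Kx\<close> and \<open>Kxy\<close> are the first and the mixed derivative of the
  kernel on the diagonal; by symmetry both first derivatives are \<open>Kx\<close> there. The
  formula for the density is then the quotient rule applied to the derivative of the
  logarithm.\<close>

lemma
  fixes m :: nat and w :: "nat \<Rightarrow> real"
  defines "Kx \<equiv> \<lambda>t. - (\<Sum>k=1..m. (w (m - k))\<^sup>2 * real k * sin (real k * t) * cos (real k * t))"
  defines "Kxy \<equiv> \<lambda>t. \<Sum>k=1..m. (w (m - k))\<^sup>2 * (real k)\<^sup>2 * (sin (real k * t))\<^sup>2"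
  assumes w: "w m > 0"
  shows kernel_diag_pos: "kernel m w t t > 0"
    and root_density_eq: "root_density m w t = sqrt (kernel m w t t * Kxy t - (Kx t)\<^sup>2) / kernel m w t t"
proof -
  show pos: "kernel m w t t > 0"
    unfolding kernel_def
    using w by (intro add_pos_nonneg sum_nonneg) (auto simp: mult.assoc)
  define L where "L x = - (\<Sum>k=1..m. (w (m - k))\<^sup>2 * real k * cos (real k * x) * sin (real k * t))" for x
  have dy: "((\<lambda>y. kernel m w x y) has_real_derivative L x) (at t)" for x
    unfolding kernel_def L_def
    by (auto intro!: derivative_eq_intros simp: sum_negf[symmetric] mult_ac)
  have dx: "((\<lambda>x. kernel m w x t) has_real_derivative Kx t) (at t)"
    unfolding kernel_def Kx_def
    by (auto intro!: derivative_eq_intros simp: sum_negf[symmetric] mult_ac)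
  have dL: "(L has_real_derivative Kxy t) (at t)"
    unfolding L_def Kxy_def
    by (auto intro!: derivative_eq_intros simp: sum_negf[symmetric] mult_ac power2_eq_square)
  have Lt: "L t = Kx t" by (simp add: L_def Kx_def mult_ac)
  \<comment> \<open>Off the diagonal the kernel may be negative, so the inner derivative is computed
    only for \<open>x\<close> near \<open>t\<close>, which is all that the outer one sees.\<close>
  have "isCont (\<lambda>x. kernel m w x t) t" using dx by (rule DERIV_isCont)
  then have "\<forall>\<^sub>F x in nhds t. kernel m w x t > 0"
    using pos by (simp add: continuous_at order_tendstoD(1) eventually_nhds_conv_at isCont_def)
  then have "\<forall>\<^sub>F x in nhds t. deriv (\<lambda>y. ln (kernel m w x y)) t = L x / kernel m w x t"
  proof (rule eventually_mono)
    fix x assume "kernel m w x t > 0"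
    then show "deriv (\<lambda>y. ln (kernel m w x y)) t = L x / kernel m w x t"
      by (intro DERIV_imp_deriv) (auto intro!: derivative_eq_intros dy)
  qed
  then have "deriv (\<lambda>x. deriv (\<lambda>y. ln (kernel m w x y)) t) t = deriv (\<lambda>x. L x / kernel m w x t) t"
    by (intro deriv_cong_ev) auto
  also have "\<dots> = (Kxy t * kernel m w t t - L t * Kx t) / (kernel m w t t * kernel m w t t)"
    using pos by (intro DERIV_imp_deriv DERIV_divide dL dx) auto
  also have "\<dots> = (kernel m w t t * Kxy t - (Kx t)\<^sup>2) / (kernel m w t t)\<^sup>2"
    unfolding Lt by (simp add: power2_eq_square mult.commute)
  finally show "root_density m w t = sqrt (kernel m w t t * Kxy t - (Kx t)\<^sup>2) / kernel m w t t"
    using pos unfolding root_density_def by (simp add: real_sqrt_divide)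
qed

text \<open>Not automatic, since \<open>sqrt\<close> is negative at negative arguments. The radicand
  is nonnegative by Cauchy-Schwarz, the constant term of the kernel only enlarging it.\<close>

lemma root_density_nonneg:
  assumes "w m > 0"
  shows "root_density m w t \<ge> 0"
proof -
  let ?x = "\<lambda>k. w (m - k) * real k * sin (real k * t)" and ?y = "\<lambda>k. w (m - k) * cos (real k * t)"
  have "(\<Sum>k=1..m. ?x k * ?y k)\<^sup>2 \<le> (\<Sum>k=1..m. (?y k)\<^sup>2) * (\<Sum>k=1..m. (?x k)\<^sup>2)"
    by (subst mult.commute, rule Cauchy_Schwarz_ineq_sum)
  also have "\<dots> \<le> kernel m w t t * (\<Sum>k=1..m. (?x k)\<^sup>2)"
    by (intro mult_right_mono sum_nonneg zero_le_power2) (simp add: kernel_def power_mult_distrib mult_ac power2_eq_square)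
  finally show ?thesis
    unfolding root_density_eq[of w m, OF assms] using kernel_diag_pos[of w m t] assms
    by (simp add: power2_eq_square mult_ac)
qed

lemma continuous_on_root_density:
  assumes "w m > 0"
  shows "continuous_on A (root_density m w)"
proof -
  have "kernel m w t t \<noteq> 0" for t using kernel_diag_pos[of w m t] assms by simp
  then show ?thesis
    unfolding root_density_eq[of w m, OF assms, abs_def]
    by (intro continuous_intros) (auto simp: kernel_def[abs_def] intro!: continuous_intros)
qed

lemma borel_measurable_count_roots_trig_poly:
  assumes "a < b"
  shows "(\<lambda>e. emeasure (count_space UNIV) (roots_in (trig_poly m w e) a b))
    \<in> borel_measurable (\<Pi>\<^sub>M i\<in>{0..m}. borel)"
proof (intro borel_measurable_count_roots assms)
  show "continuous_on {a..b} (trig_poly m w e)" for e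
    unfolding trig_poly_def[abs_def] by (intro continuous_intros)
  have "(\<lambda>e. e i) \<in> borel_measurable (\<Pi>\<^sub>M i\<in>{0..m}. (borel :: real measure))" if "i \<le> m" for i
    using that by (intro measurable_component_singleton) auto
  then show "(\<lambda>e. trig_poly m w e t) \<in> borel_measurable (\<Pi>\<^sub>M i\<in>{0..m}. borel)" for t
    unfolding trig_poly_def
    by (intro borel_measurable_add borel_measurable_times borel_measurable_sum borel_measurable_const) auto
qed

text \<open>
  Conditionally on \<open>\<eta>\<^sub>0, \<dots>, \<eta>\<^sub>m\<^sub>-\<^sub>1\<close> the roots form the level set of a fixed smooth function at the
  random level \<open>\<eta>\<^sub>m\<close>.
\<close>

lemma nn_integral_count_roots_trig_poly:
  assumes "a < b" and w: "\<And>i. i \<le> m \<Longrightarrow> w i > 0"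
  shows "(\<integral>\<^sup>+e. emeasure (count_space UNIV) (roots_in (trig_poly m w e) a b) \<partial>(\<Pi>\<^sub>M i\<in>{0..m}. std_gauss)) =
    (\<integral>\<^sup>+t. ennreal (1 / pi * root_density m w t) * indicator {a..b} t \<partial>lborel)"
proof -
  interpret gauss: prob_space std_gauss by (rule prob_space_std_gauss)
  interpret product_sigma_finite "\<lambda>_::nat. std_gauss" by unfold_locales
  let ?P = "\<Pi>\<^sub>M i\<in>{..<m}. std_gauss"
  interpret P: prob_space ?P by (intro prob_space_PiM prob_space_std_gauss)
  interpret P_lborel: pair_sigma_finite ?P lborel by unfold_locales
  have wm: "w m > 0" using w by simp
  \<comment> \<open>Division by \<open>w m / 2\<close> turns the factor \<open>1 / sqrt 2\<close>
    into \<open>sqrt 2 / w m\<close>, and the minus sign comes from solving for \<open>e m\<close>.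
    \<open>x t i\<close> is the derivative of \<open>y t i\<close> in \<open>t\<close>.\<close>
  define y where "y t i = - (sqrt 2 * w i / w m * cos (real (m - i) * t))" for t i
  define x where "x t i = sqrt 2 * w i / w m * real (m - i) * sin (real (m - i) * t)" for t i
  define h where "h e t = (\<Sum>i<m. y t i * e i)" for e t
  define h' where "h' e t = (\<Sum>i<m. x t i * e i)" for e t
  have trig: "trig_poly m w (e(m := z)) t = w m / 2 * (z - h e t)" for e z t
  proof -
    have "1 / sqrt 2 * (\<Sum>k=1..m. w (m - k) * (e(m := z)) (m - k) * cos (real k * t)) =
        (\<Sum>i<m. 1 / sqrt 2 * (w i * e i * cos (real (m - i) * t)))"
      unfolding sum_reverse_weights sum_distrib_left by (intro sum.cong) auto
    also have "\<dots> = (\<Sum>i<m. - (w m / 2) * (y t i * e i))"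
      by (intro sum.cong) (use wm in \<open>auto simp: y_def field_simps\<close>)
    finally show ?thesis
      unfolding trig_poly_def h_def sum_distrib_left[symmetric] by (simp add: algebra_simps)
  qed
  have roots: "roots_in (trig_poly m w (e(m := z))) a b = roots_in (\<lambda>t. h e t - z) a b" for e z
    unfolding roots_in_def trig using wm by auto
  have dh: "(h e has_real_derivative h' e t) (at t)" for e t
    unfolding h_def[abs_def] h'_def y_def x_def
    using wm by (auto intro!: derivative_eq_intros sum.cong simp: mult_ac)
  have conth': "continuous_on UNIV (h' e)" for e
    unfolding h'_def[abs_def] x_def by (intro continuous_intros)
  have contn: "continuous_on UNIV std_normal_density"
    unfolding normal_density_def[abs_def] by (intro continuous_intros) auto
  have ins: "{0..m} = insert m {..<m}" by auto
  have "sets (\<Pi>\<^sub>M i\<in>{0..m}. std_gauss) = sets (\<Pi>\<^sub>M i\<in>{0..m}. borel)"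
    by (intro sets_PiM_cong) auto
  then have trig_meas: "(\<lambda>e. emeasure (count_space UNIV) (roots_in (trig_poly m w e) a b))
      \<in> borel_measurable (\<Pi>\<^sub>M i\<in>insert m {..<m}. std_gauss)"
    using borel_measurable_count_roots_trig_poly[OF assms(1), of m w]
    unfolding ins[symmetric] by (simp cong: measurable_cong_sets)
  have "(\<integral>\<^sup>+e. emeasure (count_space UNIV) (roots_in (trig_poly m w e) a b) \<partial>(\<Pi>\<^sub>M i\<in>{0..m}. std_gauss)) =
      (\<integral>\<^sup>+e. (\<integral>\<^sup>+z. emeasure (count_space UNIV) (roots_in (\<lambda>t. h e t - z) a b) \<partial>std_gauss) \<partial>?P)"
    unfolding ins by (subst product_nn_integral_insert[OF _ _ trig_meas]) (auto simp: roots)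
  also have "\<dots> = (\<integral>\<^sup>+e. (\<integral>\<^sup>+t. ennreal (std_normal_density (h e t) * \<bar>h' e t\<bar>) * indicator {a..b} t \<partial>lborel) \<partial>?P)"
    by (intro nn_integral_cong nn_integral_count_level_set assms(1) dh conth' contn) simp
  also have "\<dots> = (\<integral>\<^sup>+t. (\<integral>\<^sup>+e. ennreal (std_normal_density (h e t) * \<bar>h' e t\<bar>) * indicator {a..b} t \<partial>?P) \<partial>lborel)"
    unfolding h_def h'_def y_def x_def by (rule P_lborel.Fubini'[symmetric]) measurable
  also have "\<dots> = (\<integral>\<^sup>+t. ennreal (1 / pi * root_density m w t) * indicator {a..b} t \<partial>lborel)"
  proof (rule nn_integral_cong)
    fix t
    let ?S = "1 + (\<Sum>i<m. (y t i)\<^sup>2)" and ?Q = "\<Sum>i<m. (x t i)\<^sup>2" and ?R = "\<Sum>i<m. x t i * y t i"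
    \<comment> \<open>\<open>?c\<close> is chosen to turn the constant term of the kernel into the
      noise variance \<open>1\<close> in \<open>?S\<close>. The same factor appears in
      \<open>?Q\<close> and \<open>?R\<close>, so it cancels in the quotient
      \<open>density\<close>.\<close>
    let ?c = "2 / (w m)\<^sup>2"
    have c: "?c > 0" using wm by simp
    have S: "?S = ?c * kernel m w t t"
      unfolding kernel_def sum_reverse_weights distrib_left sum_distrib_left using wm
      by (intro arg_cong2[of _ _ _ _ "(+)"] sum.cong) (auto simp: y_def power_mult_distrib power_divide power2_eq_square)
    have Q: "?Q = ?c * (\<Sum>k=1..m. (w (m - k))\<^sup>2 * (real k)\<^sup>2 * (sin (real k * t))\<^sup>2)"
      unfolding sum_reverse_weights sum_distrib_left
      by (intro sum.cong) (auto simp: x_def power_mult_distrib power_divide)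
    have R: "?R = ?c * - (\<Sum>k=1..m. (w (m - k))\<^sup>2 * real k * sin (real k * t) * cos (real k * t))"
      unfolding sum_reverse_weights sum_negf[symmetric] sum_distrib_left
      by (intro sum.cong) (auto simp: x_def y_def power2_eq_square)
    have density: "sqrt (?S * ?Q - ?R\<^sup>2) / ?S = root_density m w t"
    proof -
      have "sqrt (c * k * (c * q) - (c * r)\<^sup>2) / (c * k) = sqrt (k * q - r\<^sup>2) / k" if "c > 0" for c k q r :: real
      proof -
        have "c * k * (c * q) - (c * r)\<^sup>2 = c\<^sup>2 * (k * q - r\<^sup>2)" by (simp add: power2_eq_square algebra_simps)
        then show ?thesis using that by (simp add: real_sqrt_mult)
      qed
      then show ?thesis unfolding S Q R root_density_eq[of w m, OF wm] using c by blast
    qed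
    have "(\<integral>\<^sup>+e. ennreal (std_normal_density (h e t) * \<bar>h' e t\<bar>) \<partial>?P) = ennreal (1 / pi * sqrt (?S * ?Q - ?R\<^sup>2) / ?S)"
      unfolding h_def h'_def by (rule nn_integral_std_normal_density_mult_abs) simp
    also have "1 / pi * sqrt (?S * ?Q - ?R\<^sup>2) / ?S = 1 / pi * root_density m w t"
      unfolding density[symmetric] by (rule times_divide_eq_right[symmetric])
    finally have "(\<integral>\<^sup>+e. ennreal (std_normal_density (h e t) * \<bar>h' e t\<bar>) \<partial>?P) = ennreal (1 / pi * root_density m w t)"
      .
    moreover have "(\<lambda>e. ennreal (std_normal_density (h e t) * \<bar>h' e t\<bar>)) \<in> borel_measurable ?P"
      unfolding h_def h'_def by measurable
    ultimately show "(\<integral>\<^sup>+e. ennreal (std_normal_density (h e t) * \<bar>h' e t\<bar>) * indicator {a..b} t \<partial>?P) =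
        ennreal (1 / pi * root_density m w t) * indicator {a..b} t"
      by (subst nn_integral_multc) auto
  qed
  finally show ?thesis .
qed

text \<open>An infinite set has \<open>card\<close> zero and a non-integrable function has integral
  zero. Finiteness and both integrability claims are part of the conclusion so that the equation
  cannot rest on such default values.\<close>

theorem mainTheorem2:
  fixes M :: "'a measure" and m :: nat and w :: "nat \<Rightarrow> real"
    and \<eta> :: "nat \<Rightarrow> 'a \<Rightarrow> real" and \<beta>\<^sub>1 \<beta>\<^sub>2 :: real
  defines "N \<equiv> (\<lambda>\<omega>. roots_in (trig_poly m w (\<lambda>k. \<eta> k \<omega>)) \<beta>\<^sub>1 \<beta>\<^sub>2)"
  assumes "prob_space M"
    and "m \<ge> 1"
    and "symmetric_weights m w"
    and "prob_space.indep_vars M (\<lambda>_. borel) \<eta> {0..m}"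
    and "\<And>k. k \<le> m \<Longrightarrow> distributed M lborel (\<eta> k) std_normal_density"
    and "- pi \<le> \<beta>\<^sub>1" and "\<beta>\<^sub>1 < \<beta>\<^sub>2" and "\<beta>\<^sub>2 \<le> pi"
  shows "(AE \<omega> in M. finite (N \<omega>))
       \<and> integrable M (\<lambda>\<omega>. real (card (N \<omega>)))
       \<and> set_integrable lborel {\<beta>\<^sub>1..\<beta>\<^sub>2} (root_density m w)
       \<and> prob_space.expectation M (\<lambda>\<omega>. real (card (N \<omega>)))
           = 1 / pi * (LBINT t:{\<beta>\<^sub>1..\<beta>\<^sub>2}. root_density m w t)"
proof -
  interpret prob_space M by fact
  have w: "w i > 0" if "i \<le> m" for i
    using assms(4) that unfolding symmetric_weights_def by auto
  have \<eta>_meas [measurable]: "\<eta> k \<in> borel_measurable M" if "k \<in> {0..m}" for k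
    using distributed_measurable[OF assms(6)] that by simp
  let ?C = "\<lambda>A. emeasure (count_space UNIV) (A :: real set)"
  let ?I = "LBINT t:{\<beta>\<^sub>1..\<beta>\<^sub>2}. root_density m w t"

  have C_meas: "(\<lambda>e. ?C (roots_in (trig_poly m w e) \<beta>\<^sub>1 \<beta>\<^sub>2)) \<in> borel_measurable (\<Pi>\<^sub>M i\<in>{0..m}. borel)"
    by (rule borel_measurable_count_roots_trig_poly) fact
  have restr_meas: "(\<lambda>\<omega>. \<lambda>i\<in>{0..m}. \<eta> i \<omega>) \<in> measurable M (\<Pi>\<^sub>M i\<in>{0..m}. borel)"
    by (intro measurable_restrict \<eta>_meas)
  \<comment> \<open>Only coordinates up to \<open>m\<close> enter the polynomial, so the family may
    be restricted to them; the restriction is a point of the product space, where the joint law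
    lives.\<close>
  have N_eq: "N \<omega> = roots_in (trig_poly m w (\<lambda>i\<in>{0..m}. \<eta> i \<omega>)) \<beta>\<^sub>1 \<beta>\<^sub>2" for \<omega>
    unfolding N_def roots_in_def trig_poly_def by simp
  have CN_meas [measurable]: "(\<lambda>\<omega>. ?C (N \<omega>)) \<in> borel_measurable M"
    unfolding N_eq by (rule measurable_compose[OF restr_meas C_meas])

  have "distr M (\<Pi>\<^sub>M i\<in>{0..m}. borel) (\<lambda>\<omega>. \<lambda>i\<in>{0..m}. \<eta> i \<omega>) = (\<Pi>\<^sub>M i\<in>{0..m}. distr M borel (\<eta> i))"
    using assms(5) by (subst (asm) indep_vars_iff_distr_eq_PiM') auto
  also have "\<dots> = (\<Pi>\<^sub>M i\<in>{0..m}. std_gauss)"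
  proof (rule PiM_cong)
    fix i assume "i \<in> {0..m}"
    then have "distr M lborel (\<eta> i) = std_gauss"
      using assms(6) by (intro distributed_distr_eq_density) auto
    moreover have "distr M borel (\<eta> i) = distr M lborel (\<eta> i)" by (rule distr_cong) auto
    ultimately show "distr M borel (\<eta> i) = std_gauss" by simp
  qed simp
  finally have law: "distr M (\<Pi>\<^sub>M i\<in>{0..m}. borel) (\<lambda>\<omega>. \<lambda>i\<in>{0..m}. \<eta> i \<omega>) = (\<Pi>\<^sub>M i\<in>{0..m}. std_gauss)" .

  have int_p: "set_integrable lborel {\<beta>\<^sub>1..\<beta>\<^sub>2} (root_density m w)"
    using w by (intro borel_integrable_atLeastAtMost' continuous_on_root_density) simp
  have p0: "root_density m w t \<ge> 0" for t
    using w by (intro root_density_nonneg) simp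
  have "(\<integral>\<^sup>+\<omega>. ?C (N \<omega>) \<partial>M) =
      (\<integral>\<^sup>+e. ?C (roots_in (trig_poly m w e) \<beta>\<^sub>1 \<beta>\<^sub>2) \<partial>distr M (\<Pi>\<^sub>M i\<in>{0..m}. borel) (\<lambda>\<omega>. \<lambda>i\<in>{0..m}. \<eta> i \<omega>))"
    unfolding N_eq by (rule nn_integral_distr[OF restr_meas, symmetric]) (use C_meas in simp)
  also have "\<dots> = (\<integral>\<^sup>+t. ennreal (1 / pi * root_density m w t) * indicator {\<beta>\<^sub>1..\<beta>\<^sub>2} t \<partial>lborel)"
    unfolding law by (rule nn_integral_count_roots_trig_poly[OF assms(8) w])
  also have "\<dots> = (\<integral>\<^sup>+t. ennreal (1 / pi * (indicator {\<beta>\<^sub>1..\<beta>\<^sub>2} t *\<^sub>R root_density m w t)) \<partial>lborel)"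
    by (intro nn_integral_cong) (auto split: split_indicator)
  also have "\<dots> = ennreal (1 / pi * ?I)"
    using int_p p0 unfolding set_integrable_def set_lebesgue_integral_def
    by (subst nn_integral_eq_integral) auto
  finally have EC: "(\<integral>\<^sup>+\<omega>. ?C (N \<omega>) \<partial>M) = ennreal (1 / pi * ?I)" .

  \<comment> \<open>A finite mean of the counting measure already forces almost surely finite root
    sets; no algebra of trigonometric polynomials enters.\<close>
  have "AE \<omega> in M. ?C (N \<omega>) \<noteq> \<infinity>"
    by (rule nn_integral_PInf_AE[OF CN_meas]) (simp add: EC)
  then have fin: "AE \<omega> in M. finite (N \<omega>)"
    by (rule AE_mp) (auto intro!: AE_I2 simp: emeasure_count_space)
  \<comment> \<open>This covers infinite root sets too: \<open>enn2real\<close> sends infinity to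
    zero, just as \<open>card\<close> does. Hence \<open>card\<close> inherits
    measurability.\<close>
  have card_eq: "real (card (N \<omega>)) = enn2real (?C (N \<omega>))" for \<omega>
    by (simp add: emeasure_count_space)
  have "(\<integral>\<^sup>+\<omega>. ennreal (real (card (N \<omega>))) \<partial>M) = (\<integral>\<^sup>+\<omega>. ?C (N \<omega>) \<partial>M)"
    using fin by (intro nn_integral_cong_AE, eventually_elim) (simp add: ennreal_of_nat_eq_real_of_nat)
  then have "has_bochner_integral M (\<lambda>\<omega>. real (card (N \<omega>))) (1 / pi * ?I)"
    unfolding EC using p0
    by (intro has_bochner_integral_nn_integral)
      (auto simp: card_eq set_lebesgue_integral_def intro!: mult_nonneg_nonneg integral_nonneg)
  then show ?thesis using fin int_p by (auto simp: has_bochner_integral_iff)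
qed

end
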